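(* Let $1/2<\pi<1$ and $\delta>0$, let $\{G(n)\}$ be the random sequence of directed graphs with attachment and deletion with parameters $(\pi,\delta)$ defined in the context, and let $p_k=\lim_{n\to\infty}\mathbb{E}[p_k(n)]$, $k=0,1,2,\ldots$, be its limiting in-degree distribution. Let $$\alpha_0=\frac{\pi}{2\pi-1+\delta\pi},\qquad \alpha_2=\frac{1-\pi}{2\pi-1},$$ and, if $\alpha_0\neq\alpha_2$, let $$B=\frac{1}{\alpha_0-\alpha_2},\qquad A=-(\delta+B).$$ Write $\pi_*=3.14\ldots$ for the circle constant. Then, as $k\to\infty$, $$p_k\sim\begin{cases} c_{\pi,\delta}\,(\alpha_0/\alpha_2)^{k}\,k^{-(A+1)} & \text{if } \alpha_0<\alpha_2,\\[2pt] c_{\pi,\delta}\,e^{-2\alpha_0^{-1/2}k^{1/2}}\,k^{\delta/2-3/4} & \text{if } \alpha_0=\alpha_2,\\[2pt] c_{\pi,\delta}\,k^{-(B+1)} & \text{if } \alpha_0>\alpha_2,\end{cases}$$ where $$c_{\pi,\delta}=\begin{cases}(\alpha_2-\alpha_0)^{-(A+1)}\,\alpha_2^{A}\,\Gamma(-B)/\Gamma(\delta) & \text{if } \alpha_0<\alpha_2,\\[2pt] e^{1/(2\alpha_0)}\,\alpha_0^{-(\delta/2+1/4)}\,\sqrt{\pi_*}/\Gamma(\delta) & \text{if } \alpha_0=\alpha_2,\\[2pt] (\alpha_0-\alpha_2)^{-(B+1)}\,\alpha_0^{B}\,\Gamma(-A)/\Gamma(\delta) & \text{if } \alpha_0>\alpha_2.\end{cases}$$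 Here $a_k\sim b_k$ means $a_k/b_k\to 1$.
   Context: Model. Here $\pi$ is a model parameter (a probability), not the number $3.14\ldots$ (which is denoted $\pi_*$); the parameters are $1/2<\pi<1$ and $\delta>0$. A random sequence of directed graphs $\{G(n),\ n=0,1,2,\dots\}$ (loops allowed) is constructed as a Markov chain. $V_n$ and $E_n$ denote the vertex set and edge set of $G(n)$, $v_n=|V_n|$, $e_n=|E_n|$, and for $u\in V_n$, $d_n(u)$ is the in-degree of $u$ in $G(n)$ (a loop at $u$ contributes $1$ to its in-degree). The initial graph $G(0)$ consists of two vertices connected by a single directed edge from one to the other. For $n\ge 0$, given $G(n)$, the graph $G(n+1)$ is obtained as follows. - Addition: with probability $\pi$ if $e_n>0$, or with probability $1$ if $e_n=0$, a new vertex $w\notin V_n$ is introduced together with one directed outgoing edge $(w,u)$, where $u$ is chosen at random: $u\in V_n$ is chosen with probability $\frac{d_n(u)+\delta}{e_n+\delta v_n+\delta}$, and $u=w$ (a loop) is chosen with probability $\frac{\delta}{e_n+\delta v_n+\delta}$. Then $V_{n+1}=V_n\cup\{w\}$ and $E_{n+1}=E_n\cup\{(w,u)\}$. - Deletion: if $e_n>0$, then with the remaining probability $1-\pi$ an edge chosen uniformly at random from $E_n$ is removed, giving $E_{n+1}$, and $V_{n+1}=V_n$. For $n\ge 0$ and $k=0,1,2,\ldots$, $N_k(n)=\sum_{v\in V_n}\mathbf{1}_{\{d_n(v)=k\}}$ is the number of vertices with in-degree $k$ in $G(n)$, and $p_k(n)=N_k(n)/v_n$. For each $k$ the limit $p_k=\lim_{n\to\infty}\mathbb{E}[p_k(n)]$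 exists, and $(p_k)_{k\ge0}$ is a probability mass function on the nonnegative integers. $\Gamma$ is Euler's Gamma function. *)

theory Defs
  imports "HOL-Probability.Probability" "Graph_Theory.Pair_Digraph"
begin

text \<open>
  Every arc is the unique out-arc added together with a fresh tail, so parallel arcs never occur and
  graphs whose arcs are pairs of vertices suffice. Vertices are labelled by natural numbers; the
  label of a new vertex is the least unused one.
\<close>

type_synonym graph = "nat pair_pre_digraph"

definition indeg :: "graph \<Rightarrow> nat \<Rightarrow> nat" where
  "indeg G u = in_degree (with_proj G) u"

definition init_graph :: graph where
  "init_graph = \<lparr> pverts = {0, 1}, parcs = {(1, 0)} \<rparr>"

definition new_vertex :: "graph \<Rightarrow> nat" where
  "new_vertex G = (LEAST w. w \<notin> pverts G)"

definition target_prob :: "real \<Rightarrow> graph \<Rightarrow> nat \<Rightarrow> real" where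
  "target_prob \<delta> G u =
     (let e = real (card (parcs G)); v = real (card (pverts G)) in
      if u \<in> pverts G then (real (indeg G u) + \<delta>) / (e + \<delta> * v + \<delta>)
      else if u = new_vertex G then \<delta> / (e + \<delta> * v + \<delta>)
      else 0)"

text \<open>
  That \<open>target_prob\<close> sums to one, as \<open>embed_pmf\<close> requires, is shown in \<open>pmf_target_pmf\<close> below.
\<close>

definition target_pmf :: "real \<Rightarrow> graph \<Rightarrow> nat pmf" where
  "target_pmf \<delta> G = embed_pmf (target_prob \<delta> G)"

definition addition :: "real \<Rightarrow> graph \<Rightarrow> graph pmf" where
  "addition \<delta> G =
     map_pmf (\<lambda>u. \<lparr> pverts = insert (new_vertex G) (pverts G),
                   parcs = insert (new_vertex G, u) (parcs G) \<rparr>)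
       (target_pmf \<delta> G)"

definition deletion :: "graph \<Rightarrow> graph pmf" where
  "deletion G =
     map_pmf (\<lambda>a. \<lparr> pverts = pverts G, parcs = parcs G - {a} \<rparr>) (pmf_of_set (parcs G))"

definition step :: "real \<Rightarrow> real \<Rightarrow> graph \<Rightarrow> graph pmf" where
  "step \<pi> \<delta> G =
     (if parcs G = {} then addition \<delta> G
      else bind_pmf (bernoulli_pmf \<pi>) (\<lambda>add. if add then addition \<delta> G else deletion G))"

text \<open>
  The law of the graph at time \<open>n\<close> of the Markov chain with transition kernel \<open>step\<close>.
\<close>

primrec graph_law :: "real \<Rightarrow> real \<Rightarrow> nat \<Rightarrow> graph pmf" where
  "graph_law \<pi> \<delta> 0 = return_pmf init_graph"
| "graph_law \<pi> \<delta> (Suc n) = bind_pmf (graph_law \<pi> \<delta> n) (step \<pi> \<delta>)"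

definition degree_count :: "nat \<Rightarrow> graph \<Rightarrow> nat" where
  "degree_count k G = card {v \<in> pverts G. indeg G v = k}"

definition degree_fraction :: "nat \<Rightarrow> graph \<Rightarrow> real" where
  "degree_fraction k G = real (degree_count k G) / real (card (pverts G))"

definition expected_degree_fraction :: "real \<Rightarrow> real \<Rightarrow> nat \<Rightarrow> nat \<Rightarrow> real" where
  "expected_degree_fraction \<pi> \<delta> n k =
     measure_pmf.expectation (graph_law \<pi> \<delta> n) (degree_fraction k)"


subsection \<open>The target distribution and the reachable graphs\<close>

lemma new_vertex_notin:
  assumes "finite (pverts G)"
  shows "new_vertex G \<notin> pverts G"
  unfolding new_vertex_def by (rule LeastI_ex) (use assms ex_new_if_finite infinite_UNIV_nat in blast)

lemma sum_indeg:
  assumes "pair_fin_digraph G"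
  shows "(\<Sum>u\<in>pverts G. indeg G u) = card (parcs G)"
proof -
  interpret pair_fin_digraph G by fact
  have "card (parcs G) = card (\<Union>u\<in>pverts G. {a \<in> parcs G. snd a = u})"
    by (rule arg_cong[where f = card]) (auto dest: in_arcsD2)
  also have "\<dots> = (\<Sum>u\<in>pverts G. card {a \<in> parcs G. snd a = u})"
    by (rule card_UN_disjoint) auto
  finally show ?thesis by (simp add: indeg_def in_degree_def in_arcs_def)
qed

lemma pmf_target_pmf:
  assumes G: "pair_fin_digraph G" and \<delta>: "\<delta> > 0"
  shows "pmf (target_pmf \<delta> G) u = target_prob \<delta> G u"
  unfolding target_pmf_def
proof (rule pmf_embed_pmf)
  interpret pair_fin_digraph G by fact
  let ?w = "new_vertex G" and ?V = "pverts G"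
  let ?D = "real (card (parcs G)) + \<delta> * real (card ?V) + \<delta>"
  have D: "?D > 0" using \<delta> by (simp add: add_nonneg_pos)
  show nonneg: "target_prob \<delta> G x \<ge> 0" for x
    using \<delta> D by (auto simp: target_prob_def Let_def intro!: divide_nonneg_pos)
  have w: "?w \<notin> ?V" by (rule new_vertex_notin) simp
  have "(\<integral>\<^sup>+x. ennreal (target_prob \<delta> G x) \<partial>count_space UNIV)
      = (\<integral>\<^sup>+x. ennreal (target_prob \<delta> G x) \<partial>count_space (insert ?w ?V))"
    by (rule nn_integral_count_space_eq) (auto simp: target_prob_def Let_def)
  also have "\<dots> = (\<Sum>x\<in>insert ?w ?V. ennreal (target_prob \<delta> G x))"
    by (rule nn_integral_count_space_finite) simp
  also have "\<dots> = ennreal (\<Sum>x\<in>insert ?w ?V. target_prob \<delta> G x)"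
    by (rule sum_ennreal) (rule nonneg)
  also have "(\<Sum>x\<in>insert ?w ?V. target_prob \<delta> G x)
      = \<delta> / ?D + (\<Sum>x\<in>?V. (real (indeg G x) + \<delta>) / ?D)"
    using w by (simp add: target_prob_def Let_def)
  also have "\<dots> = (\<delta> + (real (\<Sum>x\<in>?V. indeg G x) + \<delta> * real (card ?V))) / ?D"
    by (simp add: sum_divide_distrib[symmetric] sum.distrib add_divide_distrib mult.commute)
  also have "\<dots> = 1"
    unfolding sum_indeg[OF G] using D by (simp add: add_ac)
  finally show "(\<integral>\<^sup>+x. ennreal (target_prob \<delta> G x) \<partial>count_space UNIV) = 1" by simp
qed

lemma pair_fin_digraph_graph_law:
  assumes \<delta>: "\<delta> > 0"
  shows "G \<in> set_pmf (graph_law \<pi> \<delta> n) \<Longrightarrow> pair_fin_digraph G"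
proof (induction n arbitrary: G)
  case 0
  then show ?case by unfold_locales (auto simp: init_graph_def)
next
  case (Suc n)
  then obtain H where H: "pair_fin_digraph H" and G: "G \<in> set_pmf (step \<pi> \<delta> H)" by auto
  interpret H: pair_fin_digraph H by fact
  have t: "u \<in> insert (new_vertex H) (pverts H)" if "u \<in> set_pmf (target_pmf \<delta> H)" for u
    using that by (auto simp: set_pmf_iff pmf_target_pmf[OF H \<delta>] target_prob_def Let_def split: if_splits)
  have *: "G \<in> set_pmf (addition \<delta> H) \<or> (parcs H \<noteq> {} \<and> G \<in> set_pmf (deletion H))"
    using G by (auto simp: step_def split: if_splits)
  then show ?case
  proof
    assume "G \<in> set_pmf (addition \<delta> H)"
    then obtain u where "u \<in> insert (new_vertex H) (pverts H)"
      and "G = \<lparr> pverts = insert (new_vertex H) (pverts H),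
                 parcs = insert (new_vertex H, u) (parcs H) \<rparr>"
      using t by (auto simp: addition_def)
    then show ?thesis
      by unfold_locales (auto dest: H.in_arcsD1 H.in_arcsD2)
  next
    assume "parcs H \<noteq> {} \<and> G \<in> set_pmf (deletion H)"
    then show ?thesis
      by unfold_locales (auto simp: deletion_def dest: H.in_arcsD1 H.in_arcsD2)
  qed
qed

end

theory Submission
  imports Defs "HOL-Real_Asymp.Real_Asymp"
begin

text \<open>
  The arc number is a reflected random walk, so it concentrates at \<open>(2\<pi> - 1) n\<close>, and the vertex number
  at \<open>\<pi> n\<close>. Comparing the expected one-step increment of the number of vertices of in-degree at
  most \<open>k\<close> with the average of these increments gives, for every \<open>k\<close>,
  \<open>p\<^sub>0 + \<dots> + p\<^sub>k = 1 - \<alpha>\<^sub>0 (k + \<delta>) p\<^sub>k + \<alpha>\<^sub>2 (k + 1) p\<^bsub>k+1\<^esub>\<close>.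
  This recurrence leaves \<open>p\<^sub>0\<close> free, but the difference of two solutions has unbounded partial sums
  unless it vanishes, so there is only one solution with \<open>p \<ge> 0\<close> and \<open>\<Sum>p \<le> 1\<close>. It is the law, at an
  independent exponential time, of the birth-death process with birth rates \<open>\<alpha>\<^sub>0 (k + \<delta>)\<close> and death
  rates \<open>\<alpha>\<^sub>2 k\<close> started at \<open>0\<close>. The marginals of that process are negative binomial, so \<open>p\<^sub>k\<close> is
  an explicit integral, whose asymptotics follow by rescaling and dominated convergence.
\<close>

section \<open>The expected in-degree fractions\<close>

text \<open>The constants come from following one vertex. With about \<open>(2\<pi> - 1) n\<close>
  arcs and total attachment weight about \<open>(2\<pi> - 1 + \<delta>\<pi>) n\<close> at time
  \<open>n\<close>, a vertex of in-degree \<open>k\<close> gains an arc in one step with probability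
  about \<open>\<alpha>\<^sub>0 (k + \<delta>) / n\<close> and loses one with probability about
  \<open>\<alpha>\<^sub>2 k / n\<close>, so its rates are constant in the time scale
  \<open>ln n\<close>. A typical vertex is born at a uniform fraction \<open>s\<close> of the
  elapsed time; its logarithmic age \<open>- ln s\<close> is therefore exponential, and
  \<open>s\<close> is the variable of integration. Old vertices, \<open>s\<close> near
  \<open>0\<close>, carry the tail, and the regimes differ in the limit of the negative binomial
  parameter \<open>q\<close> there: it is \<open>1\<close> if
  \<open>\<alpha>\<^sub>0 > \<alpha>\<^sub>2\<close>, whence a power law, and
  \<open>\<alpha>\<^sub>0 / \<alpha>\<^sub>2 < 1\<close> if
  \<open>\<alpha>\<^sub>0 < \<alpha>\<^sub>2\<close>, whence the geometric factor. If they are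
  equal, \<open>1 - q\<close> decays only like the reciprocal of the age, and the balance of
  \<open>q ^ k\<close> with the exponential law of the age selects ages of order
  \<open>sqrt k\<close>, which gives the stretched exponential.\<close>

lemma indeg_eq_card: "indeg G u = card {a \<in> parcs G. snd a = u}"
  by (simp add: indeg_def in_degree_def in_arcs_def)

section \<open>Effect of a single addition or deletion on degrees and counts\<close>

definition add_edge :: "graph \<Rightarrow> nat \<Rightarrow> graph" where
  "add_edge G u = \<lparr> pverts = insert (new_vertex G) (pverts G), parcs = insert (new_vertex G, u) (parcs G) \<rparr>"

definition remove_edge :: "graph \<Rightarrow> nat \<times> nat \<Rightarrow> graph" where
  "remove_edge G a = \<lparr> pverts = pverts G, parcs = parcs G - {a} \<rparr>"

text \<open>For cumulative counts, the expected increment only involves the flux between degrees \<open>k\<close> and \<open>k + 1\<close>.\<close>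

definition low_degree_count :: "nat \<Rightarrow> graph \<Rightarrow> real" where
  "low_degree_count k G = (\<Sum>v\<in>pverts G. of_bool (indeg G v \<le> k))"

lemma degree_count_eq_sum:
  "finite (pverts G) \<Longrightarrow> real (degree_count k G) = (\<Sum>v\<in>pverts G. of_bool (indeg G v = k))"
  by (simp add: degree_count_def sum.If_cases of_bool_def Int_def)

lemma low_degree_count_eq_sum:
  assumes "finite (pverts G)"
  shows "low_degree_count k G = (\<Sum>j\<le>k. real (degree_count j G))"
proof -
  have "(\<Sum>j\<le>k. real (degree_count j G)) = (\<Sum>v\<in>pverts G. \<Sum>j\<le>k. of_bool (indeg G v = j))"
    unfolding degree_count_eq_sum[OF assms] by (rule sum.swap)
  also have "\<dots> = low_degree_count k G"
    unfolding low_degree_count_def by (intro sum.cong refl) (simp add: of_bool_def sum.delta')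
  finally show ?thesis ..
qed

context
  fixes G :: graph
  assumes G: "pair_fin_digraph G"
begin

interpretation pair_fin_digraph G by (fact G)

lemma finite_graph: "finite (pverts G)" "finite (parcs G)"
  by auto

lemma new_vertex_facts:
  "new_vertex G \<notin> pverts G" "(new_vertex G, u) \<notin> parcs G" "indeg G (new_vertex G) = 0"
proof -
  show w: "new_vertex G \<notin> pverts G" by (rule new_vertex_notin) simp
  then show "(new_vertex G, u) \<notin> parcs G" by (auto dest: in_arcsD1)
  have "{a \<in> parcs G. snd a = new_vertex G} = {}" using w by (auto dest: in_arcsD2)
  then show "indeg G (new_vertex G) = 0" by (simp only: indeg_eq_card card.empty)
qed

lemma indeg_add_edge: "indeg (add_edge G u) v = indeg G v + of_bool (v = u)"
proof -
  have "{a \<in> parcs (add_edge G u). snd a = v} =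
    (if v = u then insert (new_vertex G, u) {a \<in> parcs G. snd a = v} else {a \<in> parcs G. snd a = v})"
    by (auto simp: add_edge_def)
  then show ?thesis by (simp add: indeg_eq_card new_vertex_facts)
qed

text \<open>Stated from the smaller graph upwards, so that truncated subtraction on
  \<open>nat\<close> never arises; \<open>card_remove_edge\<close> follows the same pattern.\<close>

lemma indeg_remove_edge:
  assumes "a \<in> parcs G"
  shows "indeg G v = indeg (remove_edge G a) v + of_bool (v = snd a)"
proof -
  have "{b \<in> parcs G. snd b = v} =
    (if v = snd a then insert a {b \<in> parcs (remove_edge G a). snd b = v} else {b \<in> parcs (remove_edge G a). snd b = v})"
    using assms by (auto simp: remove_edge_def)
  then show ?thesis by (simp add: indeg_eq_card remove_edge_def)
qed

lemma card_add_edge: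
  "card (pverts (add_edge G u)) = Suc (card (pverts G))" "card (parcs (add_edge G u)) = Suc (card (parcs G))"
  by (simp_all add: add_edge_def new_vertex_facts)

lemma card_remove_edge:
  "card (pverts (remove_edge G a)) = card (pverts G)"
  "a \<in> parcs G \<Longrightarrow> Suc (card (parcs (remove_edge G a))) = card (parcs G)"
  using card_Suc_Diff1[of "parcs G" a] by (simp_all add: remove_edge_def)

text \<open>The newcomer has in-degree \<open>0\<close> in \<open>G\<close> and so always adds
  \<open>1\<close>; the target is the only vertex whose in-degree changes, and it leaves the low
  class exactly when it sits at the boundary \<open>k\<close>. Allowing \<open>u\<close> to be the
  new vertex itself covers the loop.\<close>

lemma low_degree_count_add_edge:
  assumes "u \<in> insert (new_vertex G) (pverts G)"
  shows "low_degree_count k (add_edge G u) = low_degree_count k G + 1 - of_bool (indeg G u = k)"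
proof -
  let ?V = "insert (new_vertex G) (pverts G)"
  have "low_degree_count k (add_edge G u) = (\<Sum>v\<in>?V. of_bool (indeg G v + of_bool (v = u) \<le> k))"
    by (simp add: low_degree_count_def indeg_add_edge) (simp add: add_edge_def)
  also have "\<dots> = (\<Sum>v\<in>?V. of_bool (indeg G v \<le> k) - of_bool (v = u) * of_bool (indeg G u = k))"
    by (intro sum.cong) (auto simp: of_bool_def)
  also have "\<dots> = (\<Sum>v\<in>?V. of_bool (indeg G v \<le> k)) - (\<Sum>v\<in>?V. of_bool (v = u)) * of_bool (indeg G u = k)"
    by (simp only: sum_subtractf sum_distrib_right)
  also have "(\<Sum>v\<in>?V. of_bool (v = u)) = (1 :: real)"
    using assms sum.delta'[of ?V u "\<lambda>_. 1 :: real"] by (simp add: of_bool_def eq_commute del: insert_iff)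
  also have "(\<Sum>v\<in>?V. of_bool (indeg G v \<le> k)) = low_degree_count k G + 1"
    by (simp add: low_degree_count_def new_vertex_facts)
  finally show ?thesis by simp
qed

lemma low_degree_count_remove_edge:
  assumes "a \<in> parcs G"
  shows "low_degree_count k (remove_edge G a) = low_degree_count k G + of_bool (indeg G (snd a) = Suc k)"
proof -
  have snd: "snd a \<in> pverts G" using assms in_arcsD2[of "fst a" "snd a"] by simp
  have "low_degree_count k (remove_edge G a) = (\<Sum>v\<in>pverts G. of_bool (indeg (remove_edge G a) v \<le> k))"
    by (simp add: low_degree_count_def) (simp add: remove_edge_def)
  also have "\<dots> = (\<Sum>v\<in>pverts G. of_bool (indeg G v \<le> k) + of_bool (v = snd a) * of_bool (indeg G (snd a) = Suc k))"
    by (intro sum.cong) (auto simp: of_bool_def indeg_remove_edge[OF assms])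
  also have "\<dots> = low_degree_count k G + (\<Sum>v\<in>pverts G. of_bool (v = snd a)) * of_bool (indeg G (snd a) = Suc k)"
    by (simp only: sum.distrib sum_distrib_right low_degree_count_def)
  also have "(\<Sum>v\<in>pverts G. of_bool (v = snd a)) = (1 :: real)"
    using snd sum.delta'[of "pverts G" "snd a" "\<lambda>_. 1 :: real"] by (simp add: of_bool_def eq_commute)
  finally show ?thesis by simp
qed

text \<open>Grouping arcs by their heads turns the uniform choice of an arc into a degree-biased
  choice of a vertex. The resulting bound of \<open>k * degree_count k G\<close> by the arc number
  later keeps quotients by a possibly small arc number bounded.\<close>

lemma mult_degree_count_eq_card:
  "k * degree_count k G = card {a \<in> parcs G. indeg G (snd a) = k}"
proof -
  let ?V = "{v \<in> pverts G. indeg G v = k}"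
  have "{a \<in> parcs G. indeg G (snd a) = k} = (\<Union>v\<in>?V. {a \<in> parcs G. snd a = v})"
    by (auto dest: in_arcsD2)
  also have "card \<dots> = (\<Sum>v\<in>?V. card {a \<in> parcs G. snd a = v})"
    by (rule card_UN_disjoint) auto
  also have "\<dots> = (\<Sum>v\<in>?V. k)"
    by (intro sum.cong refl) (simp add: indeg_eq_card)
  finally show ?thesis by (simp add: degree_count_def)
qed

lemma mult_degree_count_le: "k * degree_count k G \<le> card (parcs G)"
  unfolding mult_degree_count_eq_card by (rule card_mono) auto

lemma degree_count_le: "degree_count k G \<le> card (pverts G)"
  unfolding degree_count_def by (rule card_mono) auto

section \<open>Expectations over one step of the chain\<close>

context
  fixes \<delta> :: real
  assumes \<delta>: "\<delta> > 0"
begin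

lemma set_target_pmf: "set_pmf (target_pmf \<delta> G) \<subseteq> insert (new_vertex G) (pverts G)"
  by (auto simp: set_pmf_iff pmf_target_pmf[OF G \<delta>] target_prob_def Let_def split: if_splits)

lemma expectation_target_pmf:
  fixes h :: "nat \<Rightarrow> real"
  shows "measure_pmf.expectation (target_pmf \<delta> G) h =
    (\<Sum>u\<in>insert (new_vertex G) (pverts G). h u * target_prob \<delta> G u)"
  using set_target_pmf
  by (subst integral_measure_pmf_real[where A = "insert (new_vertex G) (pverts G)"])
    (auto simp: pmf_target_pmf[OF G \<delta>])

lemma expectation_addition:
  "measure_pmf.expectation (addition \<delta> G) h = measure_pmf.expectation (target_pmf \<delta> G) (\<lambda>u. h (add_edge G u) :: real)"
  by (simp add: addition_def add_edge_def)

lemma expectation_deletion: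
  assumes "parcs G \<noteq> {}"
  shows "measure_pmf.expectation (deletion G) h = (\<Sum>a\<in>parcs G. h (remove_edge G a) :: real) / card (parcs G)"
  using assms by (simp add: deletion_def remove_edge_def integral_pmf_of_set)

lemma finite_addition: "finite (set_pmf (addition \<delta> G))"
  using finite_subset[OF set_target_pmf] by (simp add: addition_def)

lemma finite_deletion: "parcs G \<noteq> {} \<Longrightarrow> finite (set_pmf (deletion G))"
  by (simp add: deletion_def)

lemma finite_step: "finite (set_pmf (step \<pi> \<delta> G))"
  by (auto simp: step_def finite_addition finite_deletion)

lemma expectation_step:
  assumes "0 \<le> \<pi>" "\<pi> \<le> 1"
  shows "measure_pmf.expectation (step \<pi> \<delta> G) h =
    (if parcs G = {} then measure_pmf.expectation (addition \<delta> G) h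
     else \<pi> * measure_pmf.expectation (addition \<delta> G) h + (1 - \<pi>) * (measure_pmf.expectation (deletion G) h :: real))"
proof (cases "parcs G = {}")
  case False
  then have "measure_pmf.expectation (step \<pi> \<delta> G) h =
      (\<Sum>b\<in>UNIV. pmf (bernoulli_pmf \<pi>) b *\<^sub>R
        measure_pmf.expectation (if b then addition \<delta> G else deletion G) h)"
    by (simp only: step_def if_False)
      (rule pmf_expectation_bind, auto simp: finite_addition finite_deletion)
  then show ?thesis using False assms by (simp add: UNIV_bool)
qed (simp add: step_def)

text \<open>The summand with \<open>of_bool (k = 0)\<close> is the loop: the new vertex has
  in-degree \<open>0\<close> and a weight \<open>\<delta>\<close> of its own, so the normaliser
  counts one vertex more than \<open>pverts G\<close>.\<close>

lemma expectation_addition_low_degree_count: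
  "measure_pmf.expectation (addition \<delta> G) (low_degree_count k) = low_degree_count k G + 1 -
    ((real k + \<delta>) * real (degree_count k G) + \<delta> * of_bool (k = 0)) /
      (real (card (parcs G)) + \<delta> * real (card (pverts G)) + \<delta>)"
proof -
  let ?V = "insert (new_vertex G) (pverts G)"
  let ?D = "real (card (parcs G)) + \<delta> * real (card (pverts G)) + \<delta>"
  \<comment> \<open>Total mass one, read off from the expectation of the constant function
    \<open>1\<close>.\<close>
  have 1: "(\<Sum>u\<in>?V. target_prob \<delta> G u) = 1"
    using expectation_target_pmf[of "\<lambda>_. 1"] by simp
  have "measure_pmf.expectation (addition \<delta> G) (low_degree_count k) =
      (\<Sum>u\<in>?V. (low_degree_count k G + 1 - of_bool (indeg G u = k)) * target_prob \<delta> G u)"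
    unfolding expectation_addition expectation_target_pmf
    by (intro sum.cong refl) (simp only: low_degree_count_add_edge)
  also have "\<dots> = (low_degree_count k G + 1) * (\<Sum>u\<in>?V. target_prob \<delta> G u)
      - (\<Sum>u\<in>?V. of_bool (indeg G u = k) * target_prob \<delta> G u)"
    by (simp only: left_diff_distrib sum_subtractf sum_distrib_left)
  also have "(\<Sum>u\<in>?V. of_bool (indeg G u = k) * target_prob \<delta> G u) =
      of_bool (k = 0) * (\<delta> / ?D) + (\<Sum>u\<in>pverts G. of_bool (indeg G u = k) * ((real k + \<delta>) / ?D))"
    by (subst sum.insert) (auto simp: new_vertex_facts target_prob_def Let_def intro!: sum.cong)
  also have "\<dots> = ((real k + \<delta>) * real (degree_count k G) + \<delta> * of_bool (k = 0)) / ?D"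
    unfolding sum_distrib_right[symmetric] degree_count_eq_sum[OF finite_graph(1), symmetric]
    by (simp only: divide_inverse algebra_simps)
  finally show ?thesis by (simp only: 1 mult_1_right)
qed

lemma expectation_deletion_low_degree_count:
  assumes "parcs G \<noteq> {}"
  shows "measure_pmf.expectation (deletion G) (low_degree_count k) = low_degree_count k G +
    real (Suc k) * real (degree_count (Suc k) G) / real (card (parcs G))"
proof -
  have "(\<Sum>a\<in>parcs G. of_bool (indeg G (snd a) = Suc k)) = real (Suc k * degree_count (Suc k) G)"
    unfolding mult_degree_count_eq_card by (simp add: Int_def of_bool_def sum.If_cases)
  then show ?thesis using assms
    by (simp add: expectation_deletion low_degree_count_remove_edge sum.distrib field_simps)
qed

end

end

text \<open>Stolz-Cesaro with denominators \<open>n\<close>: beyond \<open>m\<close> the increments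
  are within \<open>r / 2\<close> of \<open>L\<close>, and the error frozen at \<open>m\<close> is
  outweighed once \<open>n\<close> exceeds \<open>N\<close>.\<close>

lemma tendsto_mean_of_increments:
  fixes u :: "nat \<Rightarrow> real"
  assumes "(\<lambda>n. u (Suc n) - u n) \<longlonglongrightarrow> L"
  shows "(\<lambda>n. u n / real n) \<longlonglongrightarrow> L"
proof (rule LIMSEQ_I)
  fix r :: real
  assume r: "r > 0"
  then obtain m where m: "\<bar>u (Suc n) - u n - L\<bar> < r / 2" if "n \<ge> m" for n
    using LIMSEQ_D[OF assms, of "r / 2"] by auto
  have bound: "\<bar>u n - L * n\<bar> \<le> \<bar>u m - L * m\<bar> + r / 2 * real (n - m)" if "n \<ge> m" for n
    using that
  proof (induction n rule: dec_induct)
    case (step n)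
    have "u (Suc n) - L * real (Suc n) = (u n - L * real n) + (u (Suc n) - u n - L)"
      by (simp add: algebra_simps)
    moreover have "r / 2 * real (Suc n - m) = r / 2 * real (n - m) + r / 2"
      using step(1) by (simp add: Suc_diff_le distrib_left)
    ultimately show ?case using m[of n] step by linarith
  qed simp
  obtain N where N: "real N > 2 * \<bar>u m - L * m\<bar> / r" using reals_Archimedean2 by blast
  show "\<exists>no. \<forall>n\<ge>no. norm (u n / real n - L) < r"
  proof (intro exI allI impI)
    fix n
    assume n: "n \<ge> Suc (max m N)"
    have "\<bar>u m - L * m\<bar> < r / 2 * real N"
      using N r by (simp add: field_simps)
    also have "\<dots> \<le> r / 2 * real n" using n r by simp
    finally have "\<bar>u n - L * n\<bar> < r / 2 * real n + r / 2 * real (n - m)"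
      using bound[of n] n by linarith
    also have "\<dots> \<le> r * real n" using r n by (simp add: field_simps)
    finally have "\<bar>u n - L * n\<bar> / real n < r" using n by (simp add: divide_simps)
    then show "norm (u n / real n - L) < r" using n by (simp add: field_simps)
  qed
qed

section \<open>The chain in time: moments of the arc number\<close>

context
  fixes \<pi> \<delta> :: real
  assumes \<pi>: "1 / 2 < \<pi>" "\<pi> < 1" and \<delta>: "\<delta> > 0"
begin

abbreviation "law \<equiv> graph_law \<pi> \<delta>"
abbreviation "mean n \<equiv> measure_pmf.expectation (law n)"

lemmas fin_digraph = pair_fin_digraph_graph_law[OF \<delta>]

text \<open>Finite support makes every real function integrable, so linearity of the mean carries no
  side conditions.\<close>

lemma finite_law: "finite (set_pmf (law n))"
proof (induction n)
  case (Suc n)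
  then show ?case using finite_step[OF fin_digraph \<delta>] by auto
qed simp

lemma integrable_law: "integrable (law n) (f :: graph \<Rightarrow> real)"
  by (rule integrable_measure_pmf_finite[OF finite_law])

lemma mean_Suc: "mean (Suc n) h = mean n (\<lambda>G. measure_pmf.expectation (step \<pi> \<delta> G) (h :: _ \<Rightarrow> real))"
proof -
  have "mean (Suc n) h = (\<Sum>G\<in>set_pmf (law n). pmf (law n) G *\<^sub>R measure_pmf.expectation (step \<pi> \<delta> G) h)"
    unfolding graph_law.simps
    by (rule pmf_expectation_bind) (auto simp: finite_law finite_step[OF fin_digraph \<delta>])
  then show ?thesis
    by (subst integral_measure_pmf_real[OF finite_law]) (auto simp: mult.commute)
qed

lemma mean_mono:
  fixes f g :: "graph \<Rightarrow> real"
  shows "(\<And>G. G \<in> set_pmf (law n) \<Longrightarrow> f G \<le> g G) \<Longrightarrow> mean n f \<le> mean n g"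
  by (rule integral_mono_AE[OF integrable_law integrable_law]) (simp add: AE_measure_pmf_iff)

text \<open>Twice the vertex number minus the arc number grows by one under either move, by
  \<open>2 - 1\<close> for an addition and by \<open>0 + 1\<close> for a deletion, and it starts at
  \<open>3\<close>. Hence the vertex number is a function of the time and the arc number, and only
  the latter has to be controlled.\<close>

lemma card_law: "G \<in> set_pmf (law n) \<Longrightarrow> 2 * card (pverts G) = n + card (parcs G) + 3"
proof (induction n arbitrary: G)
  case 0
  then show ?case by (simp add: init_graph_def)
next
  case (Suc n)
  then obtain H where H: "H \<in> set_pmf (law n)" and G: "G \<in> set_pmf (step \<pi> \<delta> H)" by auto
  note fin = fin_digraph[OF H]
  from G consider u where "G = add_edge H u" | a where "a \<in> parcs H" "G = remove_edge H a"
    using finite_graph(2)[OF fin]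
    by (auto simp: step_def addition_def deletion_def add_edge_def remove_edge_def split: if_splits)
  then show ?case
    using Suc.IH[OF H] by cases (use card_add_edge[OF fin] card_remove_edge[OF fin] in fastforce)+
qed

lemma expectation_step_card_parcs:
  assumes G: "pair_fin_digraph G"
  shows "measure_pmf.expectation (step \<pi> \<delta> G) (\<lambda>H. f (card (parcs H)) :: real) =
    (if parcs G = {} then f 1 else \<pi> * f (Suc (card (parcs G))) + (1 - \<pi>) * f (card (parcs G) - 1))"
proof -
  note finite = finite_graph[OF G]
  have add: "measure_pmf.expectation (addition \<delta> G) (\<lambda>H. f (card (parcs H))) = f (Suc (card (parcs G)))"
    unfolding expectation_addition[OF G \<delta>] by (simp add: card_add_edge[OF G])
  have del: "measure_pmf.expectation (deletion G) (\<lambda>H. f (card (parcs H))) = f (card (parcs G) - 1)"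
    if "parcs G \<noteq> {}"
  proof -
    have "(\<Sum>a\<in>parcs G. f (card (parcs (remove_edge G a)))) = (\<Sum>a\<in>parcs G. f (card (parcs G) - 1))"
      by (intro sum.cong refl) (use card_remove_edge(2)[OF G] in \<open>metis diff_Suc_1\<close>)
    then show ?thesis using that finite by (simp add: expectation_deletion[OF G \<delta> that])
  qed
  show ?thesis using \<pi> by (subst expectation_step[OF G \<delta>]) (auto simp: add del)
qed

text \<open>The reflection at an empty arc set pushes the arc number upwards, towards its typical value.\<close>

lemma second_moment_card_parcs:
  "mean n (\<lambda>G. (real (card (parcs G)) - (2 * \<pi> - 1) * real n)\<^sup>2) \<le> 1 + 4 * real n"
proof (induction n)
  case 0
  then show ?case by (simp add: init_graph_def)
next
  case (Suc n)
  define c where "c = 2 * \<pi> - 1"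
  have c: "0 < c" "c < 1" using \<pi> by (auto simp: c_def)
  have "measure_pmf.expectation (step \<pi> \<delta> G) (\<lambda>H. (real (card (parcs H)) - c * real (Suc n))\<^sup>2)
      \<le> (real (card (parcs G)) - c * real n)\<^sup>2 + 4" if "G \<in> set_pmf (law n)" for G
  proof (cases "parcs G = {}")
    case True
    have "c\<^sup>2 \<le> c" using c by (simp add: power2_eq_square mult_le_one)
    then have "c\<^sup>2 * real n \<le> c * real n" by (rule mult_right_mono) simp
    \<comment> \<open>The arc number jumps surely from \<open>0\<close> to \<open>1\<close>: its
      drift relative to the mean line, \<open>1 - c\<close>, multiplies the negative deviation
      \<open>- c n\<close>, so the cross term is nonpositive.\<close>
    have "(1 - c * real (Suc n))\<^sup>2 = (c * real n)\<^sup>2 + 2 * (c\<^sup>2 * real n - c * real n) + c\<^sup>2 + 1 - 2 * c"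
      by (simp add: power2_eq_square algebra_simps)
    also have "\<dots> \<le> (c * real n)\<^sup>2 + 4"
      using \<open>c\<^sup>2 * real n \<le> c * real n\<close> \<open>c\<^sup>2 \<le> c\<close> c by simp
    finally show ?thesis using True
      by (subst expectation_step_card_parcs[OF fin_digraph[OF that], of "\<lambda>m. (real m - c * real (Suc n))\<^sup>2"])
        simp
  next
    case False
    then have "card (parcs G) > 0"
      using finite_graph(2)[OF fin_digraph[OF that]] by (simp add: card_gt_0_iff)
    then have e: "real (card (parcs G) - Suc 0) = real (card (parcs G)) - 1" by simp
    define X where "X = real (card (parcs G)) - c * real n"
    \<comment> \<open>The increment is \<open>1\<close> or \<open>-1\<close> with mean
      \<open>c\<close>, so the cross term vanishes and only the variance \<open>1 - c^2\<close> is
      added.\<close>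
    have "\<pi> * (X + 1 - c)\<^sup>2 + (1 - \<pi>) * (X - 1 - c)\<^sup>2 = X\<^sup>2 + (1 - c\<^sup>2)"
      unfolding c_def by (simp add: power2_eq_square) algebra
    moreover have "c\<^sup>2 \<ge> 0" by simp
    ultimately have "\<pi> * (X + 1 - c)\<^sup>2 + (1 - \<pi>) * (X - 1 - c)\<^sup>2 \<le> X\<^sup>2 + 4" by linarith
    then show ?thesis using False
      by (subst expectation_step_card_parcs[OF fin_digraph[OF that], of "\<lambda>m. (real m - c * real (Suc n))\<^sup>2"])
        (simp add: X_def e algebra_simps)
  qed
  then have "mean (Suc n) (\<lambda>G. (real (card (parcs G)) - c * real (Suc n))\<^sup>2)
      \<le> mean n (\<lambda>G. (real (card (parcs G)) - c * real n)\<^sup>2 + 4)"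
    unfolding mean_Suc by (rule mean_mono)
  also have "\<dots> = mean n (\<lambda>G. (real (card (parcs G)) - c * real n)\<^sup>2) + 4"
    by (subst Bochner_Integration.integral_add[OF integrable_law integrable_law]) simp
  finally show ?case using Suc.IH by (simp add: c_def)
qed

section \<open>Convergence to zero in mean under the laws at time \<open>n\<close>\<close>

definition vanishing :: "(nat \<Rightarrow> graph \<Rightarrow> real) \<Rightarrow> bool" where
  "vanishing f \<longleftrightarrow> (\<lambda>n. mean n (\<lambda>G. \<bar>f n G\<bar>)) \<longlonglongrightarrow> 0"

lemma mean_abs_nonneg: "0 \<le> mean n (\<lambda>G. \<bar>f G :: real\<bar>)"
  by (rule Bochner_Integration.integral_nonneg) simp

lemma vanishing_mono:
  assumes "vanishing g" "\<And>n G. n > 0 \<Longrightarrow> G \<in> set_pmf (law n) \<Longrightarrow> \<bar>f n G\<bar> \<le> \<bar>g n G\<bar>"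
  shows "vanishing f"
  unfolding vanishing_def
proof (rule tendsto_sandwich[OF _ _ tendsto_const assms(1)[unfolded vanishing_def]])
  show "\<forall>\<^sub>F n in sequentially. mean n (\<lambda>G. \<bar>f n G\<bar>) \<le> mean n (\<lambda>G. \<bar>g n G\<bar>)"
    using eventually_gt_at_top[of 0] by eventually_elim (intro mean_mono assms(2))
qed (simp add: mean_abs_nonneg)

lemma vanishing_cmult: "vanishing f \<Longrightarrow> vanishing (\<lambda>n G. a * f n G)"
  unfolding vanishing_def abs_mult using tendsto_mult_right_zero by simp

lemma vanishing_add:
  assumes "vanishing f" "vanishing g"
  shows "vanishing (\<lambda>n G. f n G + g n G)"
  unfolding vanishing_def
proof (rule tendsto_sandwich[OF _ _ tendsto_const])
  show "(\<lambda>n. mean n (\<lambda>G. \<bar>f n G\<bar>) + mean n (\<lambda>G. \<bar>g n G\<bar>)) \<longlonglongrightarrow> 0"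
    using tendsto_add[OF assms[unfolded vanishing_def]] by simp
  show "\<forall>\<^sub>F n in sequentially. mean n (\<lambda>G. \<bar>f n G + g n G\<bar>) \<le> mean n (\<lambda>G. \<bar>f n G\<bar>) + mean n (\<lambda>G. \<bar>g n G\<bar>)"
    by (intro always_eventually allI,
        subst Bochner_Integration.integral_add[OF integrable_law integrable_law, symmetric])
      (intro mean_mono abs_triangle_ineq)
qed (simp add: mean_abs_nonneg)

lemma vanishing_tendsto:
  assumes "vanishing (\<lambda>n G. f n G - g n G)" "(\<lambda>n. mean n (g n)) \<longlonglongrightarrow> L"
  shows "(\<lambda>n. mean n (f n)) \<longlonglongrightarrow> L"
proof -
  have "(\<lambda>n. mean n (\<lambda>G. f n G - g n G)) \<longlonglongrightarrow> 0"
    using assms(1) unfolding vanishing_def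
    by (rule Lim_null_comparison[rotated]) (simp add: integral_norm_bound[where 'a = real, unfolded real_norm_def])
  then have "(\<lambda>n. mean n (f n) - mean n (g n)) \<longlonglongrightarrow> 0"
    by (simp add: Bochner_Integration.integral_diff[OF integrable_law integrable_law])
  from tendsto_add[OF this assms(2)] show ?thesis by simp
qed

lemma vanishing_inverse: "vanishing (\<lambda>n G. 1 / real n)"
  unfolding vanishing_def using lim_1_over_n by simp

lemma vanishing_arcs: "vanishing (\<lambda>n G. real (card (parcs G)) / real n - (2 * \<pi> - 1))"
  unfolding vanishing_def
proof (rule tendsto_sandwich[OF _ _ tendsto_const])
  let ?X = "\<lambda>n G. real (card (parcs G)) - (2 * \<pi> - 1) * real n"
  show "\<forall>\<^sub>F n in sequentially. mean n (\<lambda>G. \<bar>real (card (parcs G)) / real n - (2 * \<pi> - 1)\<bar>)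
      \<le> sqrt (1 + 4 * real n) / real n"
    using eventually_gt_at_top[of 0]
  proof eventually_elim
    case (elim n)
    define r where "r = sqrt (1 + 4 * real n)"
    have r: "r > 0" "r\<^sup>2 = 1 + 4 * real n" by (auto simp: r_def)
    have "mean n (\<lambda>G. \<bar>real (card (parcs G)) / real n - (2 * \<pi> - 1)\<bar>)
        \<le> mean n (\<lambda>G. ((?X n G)\<^sup>2 / r + r) / (2 * real n))"
    proof (rule mean_mono)
      fix G
      \<comment> \<open>The arithmetic-geometric mean inequality, with \<open>r\<close> the root of
        the second-moment bound, plays the part of Cauchy-Schwarz: the mean of
        \<open>(X^2 / r + r) / 2\<close> is at most \<open>r\<close>.\<close>
      have "0 \<le> (\<bar>?X n G\<bar> - r)\<^sup>2" by simp
      then have "2 * \<bar>?X n G\<bar> * r \<le> (?X n G)\<^sup>2 + r\<^sup>2" by (simp add: power2_diff)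
      then have "2 * \<bar>?X n G\<bar> \<le> (?X n G)\<^sup>2 / r + r"
        using r by (simp add: field_simps power2_eq_square)
      then have "\<bar>?X n G\<bar> / real n \<le> ((?X n G)\<^sup>2 / r + r) / (2 * real n)"
        using elim by (simp add: field_simps)
      moreover have "real (card (parcs G)) / real n - (2 * \<pi> - 1) = ?X n G / real n"
        using elim by (simp add: field_simps)
      ultimately show "\<bar>real (card (parcs G)) / real n - (2 * \<pi> - 1)\<bar> \<le> ((?X n G)\<^sup>2 / r + r) / (2 * real n)"
        by (simp only: abs_divide abs_of_nat)
    qed
    also have "\<dots> = (mean n (\<lambda>G. (?X n G)\<^sup>2) / r + r) / (2 * real n)"
      by (simp add: Bochner_Integration.integral_add[OF integrable_law integrable_law])
    also have "\<dots> \<le> (r\<^sup>2 / r + r) / (2 * real n)"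
      using second_moment_card_parcs[of n] r by (intro divide_right_mono add_mono) auto
    also have "\<dots> = r / real n" using r(1) by (simp add: power2_eq_square)
    finally show ?case by (simp add: r_def)
  qed
  show "(\<lambda>n. sqrt (1 + 4 * real n) / real n) \<longlonglongrightarrow> 0" by real_asymp
qed (simp add: mean_abs_nonneg)

text \<open>The first factor is the effective probability of an addition, raised from
  \<open>\<pi>\<close> to \<open>1\<close> on an empty arc set. There the deletion term vanishes on
  its own, by division by zero.\<close>

lemma step_increment:
  assumes G: "pair_fin_digraph G"
  shows "measure_pmf.expectation (step \<pi> \<delta> G) (low_degree_count k) - low_degree_count k G =
    (\<pi> + (1 - \<pi>) * of_bool (parcs G = {})) *
      (1 - ((real k + \<delta>) * real (degree_count k G) + \<delta> * of_bool (k = 0)) /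
        (real (card (parcs G)) + \<delta> * real (card (pverts G)) + \<delta>)) +
    (1 - \<pi>) * (real (Suc k) * real (degree_count (Suc k) G) / real (card (parcs G)))"
  using \<pi> by (subst expectation_step[OF G \<delta>])
    (auto simp: expectation_addition_low_degree_count[OF G \<delta>]
      expectation_deletion_low_degree_count[OF G \<delta>] algebra_simps)

text \<open>By \<open>card_law\<close> the quotient is half of \<open>1 + e / n + 3 / n\<close>,
  with \<open>e\<close> the arc number, and half of \<open>1 + (2\<pi> - 1)\<close> is
  \<open>\<pi>\<close>.\<close>

lemma vanishing_verts: "vanishing (\<lambda>n G. real (card (pverts G)) / real n - \<pi>)"
proof (rule vanishing_mono)
  show "vanishing (\<lambda>n G. 1 / 2 * (real (card (parcs G)) / real n - (2 * \<pi> - 1)) + 3 / 2 * (1 / real n))"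
    by (intro vanishing_add vanishing_cmult vanishing_arcs vanishing_inverse)
  fix n :: nat and G
  assume n: "n > 0" and G: "G \<in> set_pmf (law n)"
  have "real (card (pverts G)) = (real n + real (card (parcs G)) + 3) / 2"
    using arg_cong[OF card_law[OF G], of real] by simp
  with n have "real (card (pverts G)) / real n - \<pi> =
      1 / 2 * (real (card (parcs G)) / real n - (2 * \<pi> - 1)) + 3 / 2 * (1 / real n)"
    by (simp add: field_simps)
  then show "\<bar>real (card (pverts G)) / real n - \<pi>\<bar> \<le>
      \<bar>1 / 2 * (real (card (parcs G)) / real n - (2 * \<pi> - 1)) + 3 / 2 * (1 / real n)\<bar>"
    by simp
qed

lemma card_pverts_pos: "G \<in> set_pmf (law n) \<Longrightarrow> card (pverts G) > 0"
  using card_law[of G n] by simp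

text \<open>Passing between counts per time step and fractions of the vertices costs a factor
  \<open>degree_fraction k G\<close>, at most \<open>1\<close>, times the error in the vertex
  number.\<close>

lemma vanishing_degree_count:
  "vanishing (\<lambda>n G. real (degree_count k G) / real n - \<pi> * degree_fraction k G)"
proof (rule vanishing_mono[OF vanishing_verts])
  fix n :: nat and G
  assume n: "n > 0" and G: "G \<in> set_pmf (law n)"
  note v = card_pverts_pos[OF G]
  have "\<bar>degree_fraction k G\<bar> \<le> 1"
    using v degree_count_le[OF fin_digraph[OF G], of k] by (simp add: degree_fraction_def)
  moreover have "real (degree_count k G) / real n - \<pi> * degree_fraction k G =
      degree_fraction k G * (real (card (pverts G)) / real n - \<pi>)"
    using v n by (simp add: degree_fraction_def field_simps)
  ultimately show "\<bar>real (degree_count k G) / real n - \<pi> * degree_fraction k G\<bar>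
      \<le> \<bar>real (card (pverts G)) / real n - \<pi>\<bar>"
    by (simp add: abs_mult mult_left_le_one_le)
qed

lemma vanishing_trans:
  "vanishing (\<lambda>n G. f n G - g n G) \<Longrightarrow> vanishing (\<lambda>n G. g n G - h n G) \<Longrightarrow> vanishing (\<lambda>n G. f n G - h n G)"
  using vanishing_add[of "\<lambda>n G. f n G - g n G" "\<lambda>n G. g n G - h n G"] by simp

text \<open>Let \<open>N\<close> be the degree count, \<open>e\<close> the arc number and
  \<open>c = 2\<pi> - 1\<close>. Replacing \<open>e\<close> by \<open>c n\<close> changes the
  quotient, up to sign, by \<open>k N / e\<close> times \<open>(e / n - c) / c\<close>. As
  \<open>k N / e\<close> is at most \<open>1\<close>, the error of \<open>e\<close> transfers
  directly, however small \<open>e\<close> is.\<close>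

lemma vanishing_deletion:
  "vanishing (\<lambda>n G. real k * real (degree_count k G) / real (card (parcs G)) -
     real k * \<pi> / (2 * \<pi> - 1) * degree_fraction k G)"
proof (rule vanishing_trans)
  let ?c = "2 * \<pi> - 1"
  have c: "?c > 0" using \<pi> by simp
  show "vanishing (\<lambda>n G. real k * real (degree_count k G) / real (card (parcs G)) -
      real k / ?c * (real (degree_count k G) / real n))"
  proof (rule vanishing_mono[OF vanishing_cmult[OF vanishing_arcs]])
    fix n :: nat and G
    assume n: "n > 0" and G: "G \<in> set_pmf (law n)"
    let ?e = "real (card (parcs G))" and ?Y = "real k * real (degree_count k G)"
    have Y: "?Y \<le> ?e"
      using mult_degree_count_le[OF fin_digraph[OF G], of k] by (metis of_nat_le_iff of_nat_mult)
    show "\<bar>?Y / ?e - real k / ?c * (real (degree_count k G) / real n)\<bar> \<le> \<bar>1 / ?c * (?e / real n - ?c)\<bar>"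
    proof (cases "?e = 0")
      case True
      \<comment> \<open>Without arcs both quotients vanish: \<open>k N\<close> is zero, and division
        by zero yields zero.\<close>
      then have "?Y = 0" using Y by (metis mult_nonneg_nonneg of_nat_0_le_iff order_antisym)
      then have "real k / ?c * (real (degree_count k G) / real n) = 0" by auto
      with \<open>?Y = 0\<close> show ?thesis by (simp only: div_0 diff_0 abs_zero minus_zero abs_ge_zero)
    next
      case False
      then have "?Y / ?e - real k / ?c * (real (degree_count k G) / real n) = - (?Y / ?e) * (1 / ?c * (?e / real n - ?c))"
        using n c by (simp add: field_simps)
      moreover have "\<bar>?Y / ?e\<bar> \<le> 1" using Y False by (simp add: divide_simps)
      ultimately show ?thesis
        by (simp only: abs_mult abs_minus_cancel) (rule mult_left_le_one_le, auto)
    qed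
  qed
  show "vanishing (\<lambda>n G. real k / ?c * (real (degree_count k G) / real n) - real k * \<pi> / ?c * degree_fraction k G)"
    using vanishing_cmult[OF vanishing_degree_count, of "real k / ?c" k]
    by (simp add: right_diff_distrib mult.assoc)
qed

text \<open>The device of \<open>vanishing_deletion\<close> with the normaliser \<open>D\<close> in
  place of the arc number: now \<open>\<delta> N / D\<close> is at most \<open>1\<close>, since
  \<open>D\<close> contains \<open>\<delta>\<close> times the vertex number.\<close>

lemma vanishing_addition:
  "vanishing (\<lambda>n G. real (degree_count k G) / (real (card (parcs G)) + \<delta> * real (card (pverts G)) + \<delta>) -
     \<pi> / (2 * \<pi> - 1 + \<delta> * \<pi>) * degree_fraction k G)"
proof (rule vanishing_trans)
  let ?c = "2 * \<pi> - 1" and ?d = "2 * \<pi> - 1 + \<delta> * \<pi>"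
  have d: "?d > 0" using \<pi> \<delta> by (simp add: add_pos_pos)
  let ?h = "\<lambda>n G. (real (card (parcs G)) / real n - ?c) +
      (\<delta> * (real (card (pverts G)) / real n - \<pi>) + \<delta> * (1 / real n))"
  have "vanishing (\<lambda>n G. 1 / (\<delta> * ?d) * ?h n G)"
    by (intro vanishing_add vanishing_cmult vanishing_arcs vanishing_verts vanishing_inverse)
  then show "vanishing (\<lambda>n G. real (degree_count k G) / (real (card (parcs G)) + \<delta> * real (card (pverts G)) + \<delta>) -
      1 / ?d * (real (degree_count k G) / real n))"
  proof (rule vanishing_mono)
    fix n :: nat and G
    assume n: "n > 0" and G: "G \<in> set_pmf (law n)"
    let ?e = "real (card (parcs G))" and ?v = "real (card (pverts G))" and ?N = "real (degree_count k G)"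
    define D where "D = ?e + \<delta> * ?v + \<delta>"
    have v: "?v > 0" using card_pverts_pos[OF G] by simp
    have D: "D > 0" "\<delta> * ?v \<le> D" using \<delta> v by (auto simp: D_def intro!: add_nonneg_pos)
    have "\<delta> * ?N \<le> \<delta> * ?v"
      using degree_count_le[OF fin_digraph[OF G], of k] \<delta> by simp
    then have "\<delta> * ?N \<le> D" using D by linarith
    then have ND: "\<bar>\<delta> * ?N / D\<bar> \<le> 1" using D \<delta> by (simp add: divide_simps del: mult_le_cancel_left_pos)
    have h: "?h n G = D / real n - ?d" using n by (simp add: D_def field_simps)
    \<comment> \<open>The limiting denominator becomes a variable \<open>d\<close>, an atom for
      \<open>field_simps\<close>.\<close>
    have "?N / D - 1 / d * (?N / real n) = - (\<delta> * ?N / D) * (1 / (\<delta> * d) * (D / real n - d))" if "d > 0" for d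
      using D that \<delta> n by (simp add: field_simps)
    from this[OF d] have "?N / D - 1 / ?d * (?N / real n) = - (\<delta> * ?N / D) * (1 / (\<delta> * ?d) * ?h n G)"
      unfolding h .
    then show "\<bar>?N / (?e + \<delta> * ?v + \<delta>) - 1 / ?d * (?N / real n)\<bar> \<le> \<bar>1 / (\<delta> * ?d) * ?h n G\<bar>"
      using ND unfolding D_def[symmetric]
      by (simp only: abs_mult abs_minus_cancel) (rule mult_left_le_one_le, auto)
  qed
  show "vanishing (\<lambda>n G. 1 / ?d * (real (degree_count k G) / real n) - \<pi> / ?d * degree_fraction k G)"
    using vanishing_cmult[OF vanishing_degree_count, of "1 / ?d" k]
    by (simp add: right_diff_distrib mult.assoc)
qed

lemma vanishing_loop:
  "vanishing (\<lambda>n G. \<delta> / (real (card (parcs G)) + \<delta> * real (card (pverts G)) + \<delta>))"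
proof (rule vanishing_mono[OF vanishing_cmult[OF vanishing_inverse]])
  fix n :: nat and G
  assume n: "n > 0" and G: "G \<in> set_pmf (law n)"
  let ?D = "real (card (parcs G)) + \<delta> * real (card (pverts G)) + \<delta>"
  have "real n \<le> 2 * real (card (pverts G))"
    using arg_cong[OF card_law[OF G], of real] by simp
  then have "\<delta> * real n \<le> \<delta> * (2 * real (card (pverts G)))" using \<delta> by simp
  also have "\<dots> \<le> 2 * ?D" using \<delta> by simp
  finally have "\<delta> * real n \<le> 2 * ?D" .
  moreover have "?D > 0" using \<delta> by (simp add: add_nonneg_pos)
  ultimately show "\<bar>\<delta> / ?D\<bar> \<le> \<bar>2 * (1 / real n)\<bar>"
    using n \<delta> by (simp add: divide_simps)
qed

text \<open>Markov's inequality in disguise: without arcs the deviation in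
  \<open>vanishing_arcs\<close> has absolute value \<open>2\<pi> - 1\<close>, so the indicator is at
  most that deviation divided by \<open>2\<pi> - 1\<close>.\<close>

lemma vanishing_no_arcs: "vanishing (\<lambda>n G. of_bool (parcs G = {}))"
proof (rule vanishing_mono[OF vanishing_cmult[OF vanishing_arcs]])
  fix n :: nat and G
  show "\<bar>of_bool (parcs G = {})\<bar> \<le> \<bar>1 / (2 * \<pi> - 1) * (real (card (parcs G)) / real n - (2 * \<pi> - 1))\<bar>"
    using \<pi> by auto
qed

text \<open>The error is identically the sum of four vanishing terms, due to the forced addition on
  an empty arc set, to attachment to old vertices, to the loop and to deletion.\<close>

lemma vanishing_step_increment:
  "vanishing (\<lambda>n G. (measure_pmf.expectation (step \<pi> \<delta> G) (low_degree_count k) - low_degree_count k G) -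
     \<pi> * (1 - \<pi> / (2 * \<pi> - 1 + \<delta> * \<pi>) * (real k + \<delta>) * degree_fraction k G
       + (1 - \<pi>) / (2 * \<pi> - 1) * real (Suc k) * degree_fraction (Suc k) G))"
proof (rule vanishing_mono)
  let ?D = "\<lambda>G. real (card (parcs G)) + \<delta> * real (card (pverts G)) + \<delta>"
  let ?del = "\<lambda>G. real (Suc k) * real (degree_count (Suc k) G) / real (card (parcs G)) -
     real (Suc k) * \<pi> / (2 * \<pi> - 1) * degree_fraction (Suc k) G"
  let ?add = "\<lambda>G. real (degree_count k G) / ?D G - \<pi> / (2 * \<pi> - 1 + \<delta> * \<pi>) * degree_fraction k G"
  let ?t = "\<lambda>G. ((real k + \<delta>) * real (degree_count k G) + \<delta> * of_bool (k = 0)) / ?D G"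
  have noarcs: "vanishing (\<lambda>n G. of_bool (parcs G = {}) * (1 - ?t G))"
  proof (rule vanishing_mono[OF vanishing_no_arcs])
    fix n :: nat and G
    assume n: "n > 0" and G: "G \<in> set_pmf (law n)"
    note fin = fin_digraph[OF G]
    have D: "?D G > 0" using \<delta> by (simp add: add_nonneg_pos)
    have kN: "real k * real (degree_count k G) \<le> real (card (parcs G))"
      using mult_degree_count_le[OF fin, of k] by (metis of_nat_le_iff of_nat_mult)
    have "\<delta> * real (degree_count k G) \<le> \<delta> * real (card (pverts G))"
      using degree_count_le[OF fin, of k] \<delta> by simp
    moreover have "\<delta> * of_bool (k = 0) \<le> \<delta>" using \<delta> by simp
    ultimately have "(real k + \<delta>) * real (degree_count k G) + \<delta> * of_bool (k = 0) \<le> ?D G"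
      using kN unfolding distrib_right by linarith
    \<comment> \<open>\<open>?t G\<close> is the probability that the target has in-degree
      \<open>k\<close>.\<close>
    then have "?t G \<le> 1" using D by (simp add: divide_simps)
    moreover have "0 \<le> ?t G" using D \<delta> by (intro divide_nonneg_pos) auto
    ultimately have "\<bar>1 - ?t G\<bar> \<le> 1" by linarith
    then show "\<bar>of_bool (parcs G = {}) * (1 - ?t G)\<bar> \<le> \<bar>of_bool (parcs G = {})\<bar>"
      by (cases "parcs G = {}") simp_all
  qed
  show "vanishing (\<lambda>n G. (1 - \<pi>) * (of_bool (parcs G = {}) * (1 - ?t G)) +
      (- (\<pi> * (real k + \<delta>)) * ?add G + (- (\<pi> * of_bool (k = 0)) * (\<delta> / ?D G) + (1 - \<pi>) * ?del G)))"
    by (intro vanishing_add vanishing_cmult noarcs vanishing_addition vanishing_loop vanishing_deletion)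
  fix n :: nat and G
  assume G: "G \<in> set_pmf (law n)"
  show "\<bar>(measure_pmf.expectation (step \<pi> \<delta> G) (low_degree_count k) - low_degree_count k G) -
     \<pi> * (1 - \<pi> / (2 * \<pi> - 1 + \<delta> * \<pi>) * (real k + \<delta>) * degree_fraction k G
       + (1 - \<pi>) / (2 * \<pi> - 1) * real (Suc k) * degree_fraction (Suc k) G)\<bar> \<le>
    \<bar>(1 - \<pi>) * (of_bool (parcs G = {}) * (1 - ?t G)) +
      (- (\<pi> * (real k + \<delta>)) * ?add G + (- (\<pi> * of_bool (k = 0)) * (\<delta> / ?D G) + (1 - \<pi>) * ?del G))\<bar>"
    unfolding step_increment[OF fin_digraph[OF G]]
    by (rule eq_refl, rule arg_cong[where f = abs]) (simp add: divide_inverse algebra_simps)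
qed

lemma vanishing_low_degree_count:
  "vanishing (\<lambda>n G. low_degree_count k G / real n - \<pi> * (\<Sum>j\<le>k. degree_fraction j G))"
proof (rule vanishing_mono)
  show "vanishing (\<lambda>n G. \<Sum>j\<le>k. real (degree_count j G) / real n - \<pi> * degree_fraction j G)"
  proof (induction k)
    case (Suc k)
    then show ?case using vanishing_add[OF _ vanishing_degree_count[of "Suc k"]] by simp
  qed (simp add: vanishing_degree_count)
  fix n :: nat and G
  assume G: "G \<in> set_pmf (law n)"
  show "\<bar>low_degree_count k G / real n - \<pi> * (\<Sum>j\<le>k. degree_fraction j G)\<bar> \<le>
      \<bar>\<Sum>j\<le>k. real (degree_count j G) / real n - \<pi> * degree_fraction j G\<bar>"
    by (simp add: low_degree_count_eq_sum[OF finite_graph(1)[OF fin_digraph[OF G]]]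
        sum_subtractf sum_divide_distrib sum_distrib_left)
qed

section \<open>The recurrence for the limiting fractions\<close>

context
  fixes p :: "nat \<Rightarrow> real"
  assumes p: "\<And>k. (\<lambda>n. expected_degree_fraction \<pi> \<delta> n k) \<longlonglongrightarrow> p k"
begin

lemma mean_degree_fraction: "(\<lambda>n. mean n (degree_fraction k)) \<longlonglongrightarrow> p k"
  using p[of k] by (simp add: expected_degree_fraction_def)

lemma mean_sum_degree_fraction: "(\<lambda>n. mean n (\<lambda>G. \<Sum>j\<le>k. degree_fraction j G)) \<longlonglongrightarrow> (\<Sum>j\<le>k. p j)"
  unfolding Bochner_Integration.integral_sum[OF integrable_law]
  by (intro tendsto_sum mean_degree_fraction)

lemma limit_nonneg: "p k \<ge> 0"
  by (rule tendsto_lowerbound[OF mean_degree_fraction])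
    (auto intro!: always_eventually Bochner_Integration.integral_nonneg simp: degree_fraction_def)

lemma limit_sum_le_1: "(\<Sum>j\<le>k. p j) \<le> 1"
proof (rule tendsto_upperbound[OF mean_sum_degree_fraction])
  have "(\<Sum>j\<le>k. degree_fraction j G) \<le> 1" if "G \<in> set_pmf (law n)" for n G
  proof -
    note fin = fin_digraph[OF that]
    have "low_degree_count k G \<le> real (card (pverts G)) * 1"
      unfolding low_degree_count_def by (rule sum_bounded_above) simp
    then show ?thesis using card_pverts_pos[OF that]
      by (simp add: degree_fraction_def low_degree_count_eq_sum[OF finite_graph(1)[OF fin]]
          flip: sum_divide_distrib)
  qed
  then have "mean n (\<lambda>G. \<Sum>j\<le>k. degree_fraction j G) \<le> mean n (\<lambda>_. 1)" for n
    by (rule mean_mono)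
  then show "\<forall>\<^sub>F n in sequentially. mean n (\<lambda>G. \<Sum>j\<le>k. degree_fraction j G) \<le> 1" by simp
qed simp

lemma limit_recurrence:
  "(\<Sum>j\<le>k. p j) = 1 - \<pi> / (2 * \<pi> - 1 + \<delta> * \<pi>) * (real k + \<delta>) * p k
     + (1 - \<pi>) / (2 * \<pi> - 1) * real (Suc k) * p (Suc k)"
  (is "?S = 1 - ?a * p k + ?b * p (Suc k)")
proof -
  have "(\<lambda>n. mean n (\<lambda>G. \<pi> * (1 - ?a * degree_fraction k G + ?b * degree_fraction (Suc k) G)))
      \<longlonglongrightarrow> \<pi> * (1 - ?a * p k + ?b * p (Suc k))"
  proof -
    have "mean n (\<lambda>G. \<pi> * (1 - a * degree_fraction k G + b * degree_fraction (Suc k) G)) =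
        \<pi> * (1 - a * mean n (degree_fraction k) + b * mean n (degree_fraction (Suc k)))" for n a b
      by (simp add: Bochner_Integration.integral_add[OF integrable_law integrable_law]
        Bochner_Integration.integral_diff[OF integrable_law integrable_law])
    then show ?thesis by (simp only:) (intro tendsto_mult tendsto_add tendsto_diff tendsto_const mean_degree_fraction)
  qed
  with vanishing_step_increment
  have "(\<lambda>n. mean n (\<lambda>G. measure_pmf.expectation (step \<pi> \<delta> G) (low_degree_count k) - low_degree_count k G))
      \<longlonglongrightarrow> \<pi> * (1 - ?a * p k + ?b * p (Suc k))"
    by (rule vanishing_tendsto)
  then have "(\<lambda>n. mean (Suc n) (low_degree_count k) - mean n (low_degree_count k))
      \<longlonglongrightarrow> \<pi> * (1 - ?a * p k + ?b * p (Suc k))"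
    unfolding mean_Suc Bochner_Integration.integral_diff[OF integrable_law integrable_law] .
  then have "(\<lambda>n. mean n (low_degree_count k) / real n) \<longlonglongrightarrow> \<pi> * (1 - ?a * p k + ?b * p (Suc k))"
    by (rule tendsto_mean_of_increments)
  moreover have "(\<lambda>n. mean n (\<lambda>G. low_degree_count k G / real n)) \<longlonglongrightarrow> \<pi> * ?S"
    by (rule vanishing_tendsto[OF vanishing_low_degree_count])
      (simp, intro tendsto_intros mean_sum_degree_fraction)
  then have "(\<lambda>n. mean n (low_degree_count k) / real n) \<longlonglongrightarrow> \<pi> * ?S"
    by (simp only: integral_divide_zero)
  \<comment> \<open>Both limits carry the factor \<open>\<pi>\<close>, the number of vertices gained
    per step in the long run.\<close>
  ultimately have "\<pi> * (1 - ?a * p k + ?b * p (Suc k)) = \<pi> * ?S"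
    by (rule LIMSEQ_unique)
  then show ?thesis using \<pi> by simp
qed

end

end

section \<open>Mixtures of negative binomial laws\<close>

text \<open>A solution with \<open>d 0 > 0\<close> stays positive, since the recurrence expresses
  \<open>d (Suc k)\<close> by positive terms; then \<open>b (k + 1) d (Suc k)\<close> is at least
  the partial sum, hence at least \<open>d 0\<close>, and the harmonic series breaks the bound.
  Linearity excludes \<open>d 0 < 0\<close> as well, and \<open>d 0 = 0\<close> propagates.\<close>

lemma flux_recurrence_zero:
  fixes d :: "nat \<Rightarrow> real"
  assumes pos: "a > 0" "b > 0" "\<delta> > 0"
    and rec: "\<And>k. (\<Sum>j\<le>k. d j) = b * real (Suc k) * d (Suc k) - a * (real k + \<delta>) * d k"
    and bdd: "\<And>k. \<bar>\<Sum>j\<le>k. d j\<bar> \<le> C"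
  shows "d k = 0"
proof -
  have not_pos: "\<not> x 0 > 0"
    if rec: "\<And>k. (\<Sum>j\<le>k. x j) = b * real (Suc k) * x (Suc k) - a * (real k + \<delta>) * x k"
      and bdd: "\<And>k. (\<Sum>j\<le>k. x j) \<le> C" for x :: "nat \<Rightarrow> real"
  proof
    assume x0: "x 0 > 0"
    have x_pos: "x k > 0" for k
    proof (induction k rule: less_induct)
      case (less k)
      show ?case
      proof (cases k)
        case (Suc m)
        have "(\<Sum>j\<le>m. x j) > 0" using less Suc by (intro sum_pos) auto
        moreover have "a * (real m + \<delta>) * x m > 0" using less Suc pos by simp
        ultimately have "b * real (Suc m) * x (Suc m) > 0" using rec[of m] by linarith
        moreover have "b * real (Suc m) > 0" using pos by simp
        ultimately show ?thesis using Suc zero_less_mult_pos by blast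
      qed (simp add: x0)
    qed
    have "x (Suc k) \<ge> x 0 / b * inverse (real (Suc k))" for k
    proof -
      have "(\<Sum>j\<le>k. x j) \<ge> x 0"
        using x_pos by (intro member_le_sum) (auto intro: less_imp_le)
      moreover have "a * (real k + \<delta>) * x k \<ge> 0" using x_pos[of k] pos by simp
      ultimately have "b * real (Suc k) * x (Suc k) \<ge> x 0" using rec[of k] by linarith
      then have "x 0 / (b * real (Suc k)) \<le> x (Suc k)"
        using pos by (subst pos_divide_le_eq) (simp_all add: mult_ac del: of_nat_Suc)
      then show ?thesis by (simp add: divide_inverse mult.assoc del: of_nat_Suc)
    qed
    then have "x 0 / b * harm n \<le> (\<Sum>k<n. x (Suc k))" for n
      unfolding harm_def sum_distrib_left sum.shift_bounds_cl_Suc_ivl[symmetric] image_Suc_atLeastLessThan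
      by (simp add: sum.atLeast1_atMost_eq) (intro sum_mono, simp)
    also have "(\<Sum>k<n. x (Suc k)) \<le> C" for n
      using bdd[of n] x0 by (simp add: sum.atMost_shift)
    finally have bound: "x 0 / b * harm n \<le> C" for n .
    obtain n where "harm n > C * b / x 0"
      using harm_at_top unfolding filterlim_at_top_dense eventually_sequentially by blast
    then show False using bound[of n] x0 pos by (simp add: field_simps)
  qed
  have "\<not> d 0 > 0" using rec bdd by (intro not_pos) (auto simp: abs_le_iff)
  moreover have "\<not> - d 0 > 0"
  proof (rule not_pos)
    show "(\<Sum>j\<le>k. - d j) = b * real (Suc k) * - d (Suc k) - a * (real k + \<delta>) * - d k" for k
      by (simp add: sum_negf rec)
    show "(\<Sum>j\<le>k. - d j) \<le> C" for k
      using bdd[of k] by (simp add: sum_negf abs_le_iff)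
  qed
  ultimately have d0: "d 0 = 0" by simp
  show "d k = 0"
  proof (induction k rule: less_induct)
    case (less k)
    show ?case
    proof (cases k)
      case (Suc m)
      then have "(\<Sum>j\<le>m. d j) = 0" "d m = 0" using less by auto
      then show ?thesis using rec[of m] pos Suc by simp
    qed (simp add: d0)
  qed
qed

definition neg_binomial :: "real \<Rightarrow> nat \<Rightarrow> real \<Rightarrow> real" where
  "neg_binomial \<delta> k q = pochhammer \<delta> k / fact k * (1 - q) powr \<delta> * q ^ k"

text \<open>The point \<open>s = 0\<close> stands for infinite age and is left out, as
  \<open>growth_curve\<close> constrains \<open>q\<close> on \<open>{0<..1}\<close> alone.\<close>

definition neg_binomial_mixture :: "real \<Rightarrow> (real \<Rightarrow> real) \<Rightarrow> nat \<Rightarrow> real" where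
  "neg_binomial_mixture \<delta> q k = integral {0<..<1} (\<lambda>s. neg_binomial \<delta> k (q s))"

text \<open>
  With \<open>s = exp (- t)\<close>, these are the solutions of \<open>q' = (1 - q) (a - b q)\<close>, \<open>q = 0\<close> at \<open>t = 0\<close>: the parameter
  of the negative binomial law at time \<open>t\<close> of the process with birth rates \<open>a (k + \<delta>)\<close> and death
  rates \<open>b k\<close>. In this parametrisation an exponential time is uniform on \<open>(0, 1)\<close>.
\<close>

definition growth_curve :: "real \<Rightarrow> real \<Rightarrow> (real \<Rightarrow> real) \<Rightarrow> bool" where
  "growth_curve a b q \<longleftrightarrow> q 1 = 0 \<and> continuous_on {0<..1} q \<and>
     (\<forall>s\<in>{0<..1}. 0 \<le> q s \<and> q s < 1) \<and>
     (\<forall>s\<in>{0<..<1}. (q has_real_derivative - ((1 - q s) * (a - b * q s) / s)) (at s))"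

section \<open>Negative binomial weights as functions of the parameter \<open>q\<close>\<close>

lemma neg_binomial_coeff_Suc:
  "real (Suc k) * (pochhammer \<delta> (Suc k) / fact (Suc k)) = (\<delta> + real k) * (pochhammer \<delta> k / fact k)"
  by (simp add: pochhammer_Suc del: of_nat_Suc)

context
  fixes \<delta> :: real
  assumes \<delta>: "\<delta> > 0"
begin

lemma neg_binomial_nonneg: "0 \<le> q \<Longrightarrow> 0 \<le> neg_binomial \<delta> k q"
  using \<delta> by (simp add: neg_binomial_def pochhammer_nonneg)

text \<open>Newton's series for \<open>(1 - q) powr - \<delta>\<close> makes all the weights
  together equal to \<open>1\<close>; a partial sum drops nonnegative terms.\<close>

lemma sum_neg_binomial_le_1:
  assumes q: "0 \<le> q" "q < 1"
  shows "(\<Sum>j\<le>k. neg_binomial \<delta> j q) \<le> 1"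
proof -
  have "(\<lambda>j. (- \<delta> gchoose j) * (- q) ^ j) sums (1 + - q) powr - \<delta>"
    by (rule gen_binomial_real) (use q in auto)
  also have "(\<lambda>j. (- \<delta> gchoose j) * (- q) ^ j) = (\<lambda>j. pochhammer \<delta> j / fact j * q ^ j)"
  proof
    fix j
    have "(- 1 :: real) ^ j * (- 1) ^ j = 1" by (simp flip: power_mult_distrib)
    then show "(- \<delta> gchoose j) * (- q) ^ j = pochhammer \<delta> j / fact j * q ^ j"
      by (subst power_minus) (simp add: gbinomial_pochhammer)
  qed
  finally have sums: "(\<lambda>j. pochhammer \<delta> j / fact j * q ^ j) sums (1 - q) powr - \<delta>" by simp
  have "(\<lambda>j. neg_binomial \<delta> j q) sums 1"
    using sums_mult[OF sums, of "(1 - q) powr \<delta>"] q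
    by (simp add: neg_binomial_def mult_ac flip: powr_add)
  then have "(\<Sum>j<Suc k. neg_binomial \<delta> j q) \<le> 1"
    by (subst sums_unique, assumption)
      (rule sum_le_suminf, auto intro: neg_binomial_nonneg[OF q(1)] sums_summable)
  then show ?thesis by (simp only: lessThan_Suc_atMost)
qed

lemma neg_binomial_le_1:
  assumes "0 \<le> q" "q < 1"
  shows "neg_binomial \<delta> k q \<le> 1"
  using member_le_sum[of k "{..k}" "\<lambda>j. neg_binomial \<delta> j q"] neg_binomial_nonneg[OF assms(1)]
    sum_neg_binomial_le_1[OF assms, of k] by force

text \<open>The derivative of each weight is a difference of consecutive terms of the displayed
  form, by \<open>neg_binomial_coeff_Suc\<close>, so the sum telescopes to its last term. This is
  the differential counterpart of counting low degrees cumulatively.\<close>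

lemma has_real_derivative_sum_neg_binomial:
  assumes "q < 1"
  shows "((\<lambda>q. \<Sum>j\<le>k. neg_binomial \<delta> j q) has_real_derivative
    - ((\<delta> + real k) * (pochhammer \<delta> k / fact k) * (1 - q) powr (\<delta> - 1) * q ^ k)) (at q)"
proof (induction k)
  case 0
  show ?case unfolding neg_binomial_def
    using assms by (auto intro!: derivative_eq_intros)
next
  case (Suc k)
  define C where "C = pochhammer \<delta> (Suc k) / fact (Suc k)"
  define D where "D = (1 - q) powr (\<delta> - 1)"
  have D: "(1 - q) powr \<delta> = D * (1 - q)"
    using assms by (simp add: D_def powr_diff)
  have "((\<lambda>q. neg_binomial \<delta> (Suc k) q) has_real_derivative
      C * (- \<delta> * D * q ^ Suc k + (1 - q) powr \<delta> * (real (Suc k) * q ^ k))) (at q)"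
    unfolding neg_binomial_def C_def[symmetric] D_def
    using assms by (auto intro!: derivative_eq_intros simp del: power_Suc of_nat_Suc simp: algebra_simps)
  from DERIV_add[OF Suc this] show ?case
    unfolding neg_binomial_coeff_Suc[symmetric] C_def[symmetric] D_def[symmetric] D
    by (simp add: algebra_simps)
qed

section \<open>Mixtures along a growth curve\<close>

context
  fixes q :: "real \<Rightarrow> real" and a b :: real
  assumes curve: "growth_curve a b q"
begin

lemma
  growth_curve_range: "0 < s \<Longrightarrow> s \<le> 1 \<Longrightarrow> 0 \<le> q s \<and> q s < 1" and growth_curve_at_1: "q 1 = 0" and
  growth_curve_continuous: "continuous_on {0<..1} q" and
  growth_curve_derivative: "0 < s \<Longrightarrow> s < 1 \<Longrightarrow> (q has_real_derivative - ((1 - q s) * (a - b * q s) / s)) (at s)"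
  using curve by (simp_all add: growth_curve_def)

lemma neg_binomial_mixture_integrable:
  "(\<lambda>s. neg_binomial \<delta> k (q s)) integrable_on {0<..<1}"
proof (rule measurable_bounded_by_integrable_imp_integrable)
  have "continuous_on {0<..<1} (\<lambda>s. neg_binomial \<delta> k (q s))"
    unfolding neg_binomial_def using growth_curve_range \<delta>
    by (intro continuous_intros continuous_on_subset[OF growth_curve_continuous]) force+
  then show "(\<lambda>s. neg_binomial \<delta> k (q s)) \<in> borel_measurable (lebesgue_on {0<..<1})"
    by (rule continuous_imp_measurable_on_sets_lebesgue) simp
  show "(\<lambda>_. 1 :: real) integrable_on {0<..<1::real}" using integrable_const_ivl[of "1 :: real" 0 "1 :: real"] by (simp only: integrable_on_Icc_iff_Ioo)
qed (use growth_curve_range neg_binomial_nonneg neg_binomial_le_1 in auto)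

abbreviation "mixture k \<equiv> neg_binomial_mixture \<delta> q k"

lemma neg_binomial_mixture_absolutely_integrable:
  "(\<lambda>s. neg_binomial \<delta> k (q s)) absolutely_integrable_on {0<..<1}"
  by (rule nonnegative_absolutely_integrable_1[OF neg_binomial_mixture_integrable])
    (use growth_curve_range neg_binomial_nonneg in auto)

lemma neg_binomial_mixture_nonneg: "mixture k \<ge> 0"
  unfolding neg_binomial_mixture_def
  by (rule integral_nonneg[OF neg_binomial_mixture_integrable]) (use growth_curve_range neg_binomial_nonneg in auto)

lemma neg_binomial_mixture_sum_le_1: "(\<Sum>j\<le>k. mixture j) \<le> 1"
proof -
  have "(\<Sum>j\<le>k. mixture j) = integral {0<..<1} (\<lambda>s. \<Sum>j\<le>k. neg_binomial \<delta> j (q s))"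
    unfolding neg_binomial_mixture_def by (rule integral_sum[symmetric]) (auto intro: neg_binomial_mixture_integrable)
  also have "\<dots> \<le> integral {0<..<1} (\<lambda>s :: real. 1)"
    using growth_curve_range
    by (intro integral_le integrable_sum neg_binomial_mixture_integrable)
      (auto intro!: sum_neg_binomial_le_1 simp flip: integrable_on_Icc_iff_Ioo)
  finally show ?thesis by (simp add: integral_open_interval_real[symmetric])
qed

text \<open>Integration by parts against the uniform law: the derivative of \<open>s\<close> times
  the cumulative weight is that weight plus a flux, because the factor \<open>s\<close> cancels the
  \<open>1 / s\<close> of the growth curve. The constant \<open>1\<close> is the boundary value at
  \<open>s = 1\<close>, where \<open>q = 0\<close> puts all mass on degree \<open>0\<close>.\<close>

lemma neg_binomial_mixture_flux:
  "(\<Sum>j\<le>k. mixture j) = 1 - a * (real k + \<delta>) * mixture k + b * real (Suc k) * mixture (Suc k)"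
proof -
  let ?S = "\<lambda>s. \<Sum>j\<le>k. neg_binomial \<delta> j (q s)"
  let ?f = "\<lambda>s. ?S s + a * (real k + \<delta>) * neg_binomial \<delta> k (q s)
      - b * real (Suc k) * neg_binomial \<delta> (Suc k) (q s)"
  have deriv: "((\<lambda>s. s * ?S s) has_real_derivative ?f s) (at s)" if s: "s \<in> {0<..<1}" for s
  proof -
    have q: "q s < 1" using growth_curve_range[of s] s by simp
    let ?C = "pochhammer \<delta> k / fact k"
    have D: "(1 - q s) powr \<delta> = (1 - q s) powr (\<delta> - 1) * (1 - q s)"
      using q by (simp add: powr_diff)
    have "(?S has_real_derivative
      - ((\<delta> + real k) * ?C * (1 - q s) powr (\<delta> - 1) * q s ^ k) * - ((1 - q s) * (a - b * q s) / s)) (at s)"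
      using DERIV_chain2[OF has_real_derivative_sum_neg_binomial[OF q] growth_curve_derivative] s by simp
    from DERIV_mult[OF DERIV_ident this]
    have "((\<lambda>s. s * ?S s) has_real_derivative
      ?S s + (\<delta> + real k) * ?C * (1 - q s) powr \<delta> * q s ^ k * (a - b * q s)) (at s)"
      unfolding D by (rule DERIV_cong) (use s in \<open>simp add: field_simps\<close>)
    also have "(\<delta> + real k) * ?C * (1 - q s) powr \<delta> * q s ^ k * (a - b * q s) =
      a * (real k + \<delta>) * neg_binomial \<delta> k (q s) - b * ((\<delta> + real k) * ?C) * (1 - q s) powr \<delta> * q s ^ Suc k"
      by (simp add: neg_binomial_def divide_inverse algebra_simps)
    also have "b * ((\<delta> + real k) * ?C) * (1 - q s) powr \<delta> * q s ^ Suc k =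
      b * real (Suc k) * neg_binomial \<delta> (Suc k) (q s)"
      by (simp only: neg_binomial_coeff_Suc[symmetric] neg_binomial_def mult_ac)
    finally show ?thesis by (simp add: add_diff_eq)
  qed
  \<comment> \<open>\<open>growth_curve\<close> leaves \<open>q\<close> free at \<open>0\<close>; as
    \<open>?S\<close> stays in \<open>[0, 1]\<close> for positive \<open>s\<close>, the factor
    \<open>s\<close> makes the product continuous there, with value \<open>0\<close>.\<close>
  have cont: "continuous_on {0..1} (\<lambda>s. s * ?S s)"
    unfolding continuous_on_eq_continuous_within
  proof
    fix s :: real
    assume s: "s \<in> {0..1}"
    show "continuous (at s within {0..1}) (\<lambda>s. s * ?S s)"
    proof (cases "s = 0")
      case True
      have "((\<lambda>s. s * ?S s) \<longlongrightarrow> 0) (at 0 within {0..1})"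
      proof (rule Lim_null_comparison)
        show "((\<lambda>s :: real. s) \<longlongrightarrow> 0) (at 0 within {0..1})" by (rule tendsto_ident_at)
        show "\<forall>\<^sub>F s in at 0 within {0..1}. norm (s * ?S s) \<le> s"
          unfolding eventually_at_filter
        proof (intro always_eventually allI impI)
          fix s :: real
          assume "s \<noteq> 0" "s \<in> {0..1}"
          then have "0 \<le> ?S s" "?S s \<le> 1"
            using growth_curve_range[of s] by (auto intro!: sum_nonneg neg_binomial_nonneg sum_neg_binomial_le_1)
          with \<open>s \<in> {0..1}\<close> show "norm (s * ?S s) \<le> s" by (simp add: abs_mult mult_left_le)
        qed
      qed
      then show ?thesis using True by (simp add: continuous_within)
    next
      case False
      have "continuous_on {0<..1} (\<lambda>s. s * ?S s)"
        unfolding neg_binomial_def using growth_curve_range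
        by (intro continuous_intros growth_curve_continuous) force+
      then have "continuous (at s within {0<..1}) (\<lambda>s. s * ?S s)"
        using s False by (simp add: continuous_on_eq_continuous_within)
      moreover have "at s within {0<..1} = at s within {0..1}"
        by (rule at_within_nhd[of s "{0<..}"]) (use s False in auto)
      ultimately show ?thesis by simp
    qed
  qed
  have "(?f has_integral 1 * ?S 1 - 0 * ?S 0) {0..1}"
    using deriv cont by (intro fundamental_theorem_of_calculus_interior)
      (auto simp: has_real_derivative_iff_has_vector_derivative)
  moreover have "?S 1 = 1"
    by (simp add: neg_binomial_def growth_curve_at_1 sum.atMost_shift)
  ultimately have "(?f has_integral 1) {0<..<1}" by (simp add: has_integral_Icc_iff_Ioo)
  then have "integral {0<..<1} ?f = 1" by (rule integral_unique)
  moreover have "integral {0<..<1} ?f = (\<Sum>j\<le>k. mixture j) + a * (real k + \<delta>) * mixture k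
      - b * real (Suc k) * mixture (Suc k)"
    unfolding neg_binomial_mixture_def
    by (simp add: integral_add integral_diff integral_sum integrable_add integrable_sum
        integrable_on_mult_right neg_binomial_mixture_integrable)
  ultimately show ?thesis by linarith
qed

lemma neg_binomial_mixture_unique:
  fixes p :: "nat \<Rightarrow> real"
  assumes "a > 0" "b > 0"
    and p: "\<And>k. p k \<ge> 0" "\<And>k. (\<Sum>j\<le>k. p j) \<le> 1"
    and rec: "\<And>k. (\<Sum>j\<le>k. p j) = 1 - a * (real k + \<delta>) * p k + b * real (Suc k) * p (Suc k)"
  shows "p k = mixture k"
proof -
  have "p k - mixture k = 0"
  proof (rule flux_recurrence_zero[where a = a and b = b and \<delta> = \<delta> and C = 1])
    fix k
    show "(\<Sum>j\<le>k. p j - mixture j) = b * real (Suc k) * (p (Suc k) - mixture (Suc k))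
        - a * (real k + \<delta>) * (p k - mixture k)"
      unfolding sum_subtractf neg_binomial_mixture_flux rec by (simp add: algebra_simps)
    have "(\<Sum>j\<le>k. p j) \<ge> 0" "(\<Sum>j\<le>k. mixture j) \<ge> 0"
      by (auto intro!: sum_nonneg p neg_binomial_mixture_nonneg)
    then show "\<bar>\<Sum>j\<le>k. p j - mixture j\<bar> \<le> 1"
      using p(2)[of k] neg_binomial_mixture_sum_le_1[of k] unfolding sum_subtractf by linarith
  qed (use assms \<delta> in auto)
  then show ?thesis by simp
qed

end

end

section \<open>Asymptotics of the mixtures\<close>

lemma neg_binomial_coeff_asymp:
  fixes \<delta> :: real
  assumes \<delta>: "\<delta> > 0"
  shows "(\<lambda>k. pochhammer \<delta> k / fact k * real k powr (1 - \<delta>)) \<longlonglongrightarrow> 1 / Gamma \<delta>"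
proof -
  \<comment> \<open>\<open>rGamma_series\<close> has the Pochhammer symbol of length
    \<open>k + 1\<close>; the correction, which tends to \<open>1\<close>, divides out its last
    factor \<open>\<delta> + k\<close> and supplies a power of \<open>k\<close>.\<close>
  have "(\<lambda>k. rGamma_series \<delta> k * (real k / (\<delta> + real k))) \<longlonglongrightarrow> rGamma \<delta> * 1"
    by (intro tendsto_mult rGamma_series_LIMSEQ) real_asymp
  moreover have "\<forall>\<^sub>F k in sequentially. rGamma_series \<delta> k * (real k / (\<delta> + real k)) =
      pochhammer \<delta> k / fact k * real k powr (1 - \<delta>)"
    using eventually_gt_at_top[of 0]
  proof eventually_elim
    case (elim k)
    have "\<delta> + real k > 0" using \<delta> by simp
    moreover have "exp ((1 - \<delta>) * ln (real k)) = real k / exp (\<delta> * ln (real k))"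
      using elim by (simp add: algebra_simps exp_diff)
    ultimately show ?case using elim
      by (simp add: rGamma_series_def pochhammer_Suc powr_def)
  qed
  ultimately show ?thesis
    by (simp add: rGamma_inverse_Gamma inverse_eq_divide Lim_transform_eventually)
qed

section \<open>Change of variables, Gamma integrals and dominated convergence\<close>

lemma integral_substitution:
  fixes f g :: "real \<Rightarrow> real"
  assumes "S \<in> sets lebesgue" "\<And>x. x \<in> S \<Longrightarrow> (g has_field_derivative g' x) (at x)"
    and "inj_on g S" "f absolutely_integrable_on g ` S"
  shows "(\<lambda>x. \<bar>g' x\<bar> * f (g x)) absolutely_integrable_on S"
    and "integral S (\<lambda>x. \<bar>g' x\<bar> * f (g x)) = integral (g ` S) f"
  using has_absolute_integral_change_of_variables_1'[OF assms(1) has_field_derivative_at_within[OF assms(2)] assms(3),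
      where f = f and b = "integral (g ` S) f"]
    assms(4) by blast+

lemma has_integral_Gamma_scaled:
  fixes a c :: real
  assumes "a > 0" "c > 0"
  shows "((\<lambda>y. y powr (a - 1) * exp (- c * y)) has_integral Gamma a * c powr - a) {0<..}"
proof -
  have abs: "(\<lambda>t. t powr (a - 1) / exp t) absolutely_integrable_on {0..}"
    using Gamma_integral_real[OF assms(1)]
    by (intro nonnegative_absolutely_integrable_1) auto
  have ae: "(\<lambda>t. t powr (a - 1) / exp t) absolutely_integrable_on {0<..}"
    by (rule set_integrable_subset[OF abs]) auto
  have val: "integral {0<..} (\<lambda>t. t powr (a - 1) / exp t) = Gamma a"
  proof -
    have "((\<lambda>t. t powr (a - 1) / exp t) has_integral Gamma a) {0<..}"
      by (rule has_integral_spike_set_eq[THEN iffD1, OF negligible_subset[of "{0}"] negligible_subset[of "{0}"]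
          Gamma_integral_real[OF assms(1)]]) auto
    then show ?thesis by (rule integral_unique)
  qed
  have img: "(*) c ` {0<..} = {0<..}"
  proof -
    have "x \<in> (*) c ` {0<..}" if "x > 0" for x
      using that assms by (intro image_eqI[of _ _ "x / c"]) auto
    then show ?thesis using assms by auto
  qed
  have der: "((*) c has_field_derivative c) (at x)" for x
    by (auto intro!: derivative_eq_intros)
  have inj: "inj_on ((*) c) {0<..}" using assms by (auto intro!: inj_onI)
  note sub = integral_substitution[of "{0<..}" "(*) c" "\<lambda>_. c" "\<lambda>t. t powr (a - 1) / exp t", unfolded img, OF _ der inj ae]
  have "(\<lambda>y. \<bar>c\<bar> * ((c * y) powr (a - 1) / exp (c * y))) integrable_on {0<..}"
    using sub(1) by (simp add: set_lebesgue_integral_eq_integral)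
  then have "((\<lambda>y. \<bar>c\<bar> * ((c * y) powr (a - 1) / exp (c * y))) has_integral Gamma a) {0<..}"
    using sub(2) val by (simp add: has_integral_iff)
  then have "((\<lambda>y. c powr - a * (\<bar>c\<bar> * ((c * y) powr (a - 1) / exp (c * y)))) has_integral c powr - a * Gamma a) {0<..}"
    by (rule has_integral_mult_right)
  moreover have "c powr - a * (\<bar>c\<bar> * ((c * y) powr (a - 1) / exp (c * y))) = y powr (a - 1) * exp (- c * y)"
    if "y \<in> {0<..}" for y
  proof -
    have "c powr - a * (c * c powr (a - 1)) = 1"
      using assms by (simp add: powr_minus powr_diff)
    then have "y powr (a - 1) * exp (- c * y) = c powr - a * (c * c powr (a - 1)) * (y powr (a - 1) * exp (- c * y))"
      by simp
    also have "\<dots> = c powr - a * (\<bar>c\<bar> * ((c * y) powr (a - 1) / exp (c * y)))"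
      using that assms by (simp add: powr_mult exp_minus divide_inverse mult_ac)
    finally show ?thesis ..
  qed
  ultimately have "((\<lambda>y. y powr (a - 1) * exp (- c * y)) has_integral c powr - a * Gamma a) {0<..}"
    by (rule has_integral_eq[rotated])
  then show ?thesis by (simp only: mult.commute)
qed

text \<open>Rescaling makes the interval of integration grow with \<open>k\<close>. Each
  \<open>f k\<close> is extended by zero to \<open>S\<close>, where the ordinary theorem applies; by
  \<open>ev\<close> a fixed point is eventually inside \<open>T k\<close>. The bounds start at
  \<open>K\<close>, hence the shift of the index.\<close>

lemma dominated_convergence_moving_domain:
  fixes f :: "nat \<Rightarrow> real \<Rightarrow> real"
  assumes T: "\<And>k. T k \<in> sets lebesgue" "\<And>k. T k \<subseteq> S" and S: "S \<in> sets lebesgue"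
    and cont: "\<And>k. k \<ge> K \<Longrightarrow> continuous_on (T k) (f k)"
    and h: "h integrable_on S" "\<And>x. x \<in> S \<Longrightarrow> h x \<ge> 0"
    and bound: "\<And>k x. k \<ge> K \<Longrightarrow> x \<in> T k \<Longrightarrow> \<bar>f k x\<bar> \<le> h x"
    and ev: "\<And>x. x \<in> S \<Longrightarrow> \<forall>\<^sub>F k in sequentially. x \<in> T k"
    and lim: "\<And>x. x \<in> S \<Longrightarrow> (\<lambda>k. f k x) \<longlonglongrightarrow> g x"
  shows "(\<lambda>k. integral (T k) (f k)) \<longlonglongrightarrow> integral S g"
proof -
  define F where "F = (\<lambda>k x. if x \<in> T (k + K) then f (k + K) x else 0)"
  have "h absolutely_integrable_on S"
    by (rule nonnegative_absolutely_integrable_1) (use h in auto)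
  then have "h absolutely_integrable_on T k" for k
    by (rule set_integrable_subset) (use T in auto)
  then have hT: "h integrable_on T k" for k
    by (rule set_lebesgue_integral_eq_integral(1))
  have "f k integrable_on T k" if "k \<ge> K" for k
  proof (rule measurable_bounded_by_integrable_imp_integrable)
    show "f k \<in> borel_measurable (lebesgue_on (T k))"
      by (rule continuous_imp_measurable_on_sets_lebesgue[OF cont[OF that] T(1)])
  qed (use hT T(1) bound[OF that] in simp_all)
  then have "F k integrable_on S" for k
    unfolding F_def integrable_restrict_Int using T(2)[of "k + K"] by (simp add: Int_absorb2)
  then have "(\<lambda>k. integral S (F k)) \<longlonglongrightarrow> integral S g"
  proof (rule dominated_convergence(2)[OF _ h(1)])
    show "norm (F k x) \<le> h x" if "x \<in> S" for k x
      using that bound h(2) by (simp add: F_def)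
    show "(\<lambda>k. F k x) \<longlonglongrightarrow> g x" if "x \<in> S" for x
    proof (rule Lim_transform_eventually)
      show "(\<lambda>k. f (k + K) x) \<longlonglongrightarrow> g x" using lim[OF that] by (rule LIMSEQ_ignore_initial_segment)
      show "\<forall>\<^sub>F k in sequentially. f (k + K) x = F k x"
        using eventually_sequentially_seg[THEN iffD2, OF ev[OF that], of K]
        by eventually_elim (simp add: F_def)
    qed
  qed
  moreover have "integral S (F k) = integral (T (k + K)) (f (k + K))" for k
    unfolding F_def Henstock_Kurzweil_Integration.integral_restrict_Int
    using T(2)[of "k + K"] by (simp add: Int_absorb2)
  ultimately show ?thesis by (simp add: LIMSEQ_offset)
qed

text \<open>The \<open>k\<close>-th power tends to \<open>exp (- (1 - \<rho>) * y)\<close> and the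
  factor with exponent \<open>- \<delta>\<close> to \<open>1\<close>, leaving a scaled Gamma
  integral. Both regimes with unequal rates reduce to this kernel, with \<open>\<rho>\<close> the
  smaller rate divided by the larger.\<close>

lemma rational_kernel_limit:
  fixes \<rho> a \<delta> :: real
  assumes \<rho>: "0 \<le> \<rho>" "\<rho> < 1" and a: "a > 0" and \<delta>: "\<delta> > 0"
  shows "(\<lambda>k. integral {0<..<real k} (\<lambda>y. y powr (a - 1) * (1 - \<rho> * (y / real k)) powr - \<delta> *
    ((1 - y / real k) / (1 - \<rho> * (y / real k))) ^ k)) \<longlonglongrightarrow> Gamma a * (1 - \<rho>) powr - a"
    (is "(\<lambda>k. integral _ (?f k)) \<longlonglongrightarrow> _")
proof -
  define h where "h = (\<lambda>y. (1 - \<rho>) powr - \<delta> * (y powr (a - 1) * exp (- (1 - \<rho>) * y)))"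
  have Gamma: "((\<lambda>y. y powr (a - 1) * exp (- (1 - \<rho>) * y)) has_integral Gamma a * (1 - \<rho>) powr - a) {0<..}"
    using assms by (intro has_integral_Gamma_scaled) auto
  have dens: "1 - \<rho> \<le> 1 - \<rho> * x \<and> 0 < 1 - \<rho> * x" if "x < 1" for x
  proof -
    have "\<rho> * x \<le> \<rho> * 1" using \<rho> that by (intro mult_left_mono) auto
    then show ?thesis using \<rho> by auto
  qed
  have bound: "norm (?f k y) \<le> h y" if y: "y \<in> {0<..<real k}" for k y
  proof -
    define x where "x = y / real k"
    have x: "0 < x" "x < 1" using y by (auto simp: x_def)
    note d = dens[OF x(2)]
    \<comment> \<open>The surplus \<open>\<rho> (1 - \<rho>) x^2\<close> is nonnegative, so the base
      is at most \<open>1 - (1 - \<rho>) x\<close>; its \<open>k\<close>-th power is dominated by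
      the limiting exponential itself.\<close>
    have "(1 - (1 - \<rho>) * x) * (1 - \<rho> * x) = (1 - x) + \<rho> * (1 - \<rho>) * x\<^sup>2"
      by (simp add: algebra_simps power2_eq_square)
    then have "1 - x \<le> (1 - (1 - \<rho>) * x) * (1 - \<rho> * x)"
      using \<rho> by simp
    then have "(1 - x) / (1 - \<rho> * x) \<le> 1 + - ((1 - \<rho>) * x)"
      using d by (simp add: pos_divide_le_eq)
    also have "\<dots> \<le> exp (- ((1 - \<rho>) * x))" by (rule exp_ge_add_one_self)
    finally have "((1 - x) / (1 - \<rho> * x)) ^ k \<le> exp (- ((1 - \<rho>) * x)) ^ k"
      using d x by (intro power_mono divide_nonneg_pos) auto
    also have "\<dots> = exp (- (1 - \<rho>) * y)"
    proof -
      have "real k * - ((1 - \<rho>) * x) = - (1 - \<rho>) * (real k * x)" by algebra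
      also have "real k * x = y" using y by (simp add: x_def)
      finally show ?thesis by (simp only: exp_of_nat_mult[symmetric])
    qed
    finally have 1: "((1 - x) / (1 - \<rho> * x)) ^ k \<le> exp (- (1 - \<rho>) * y)" .
    have 2: "(1 - \<rho> * x) powr - \<delta> \<le> (1 - \<rho>) powr - \<delta>"
      using d \<rho> \<delta> by (intro powr_mono2') auto
    have 3: "((1 - x) / (1 - \<rho> * x)) ^ k \<ge> 0"
      using d x by (intro zero_le_power divide_nonneg_pos) auto
    have "?f k y \<le> y powr (a - 1) * (1 - \<rho>) powr - \<delta> * exp (- (1 - \<rho>) * y)"
      unfolding x_def[symmetric] by (intro mult_mono 1 2 3 mult_nonneg_nonneg mult_left_mono) auto
    moreover have "?f k y \<ge> 0" unfolding x_def[symmetric] by (intro mult_nonneg_nonneg 3) auto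
    ultimately show ?thesis by (simp add: h_def mult_ac)
  qed
  have "(\<lambda>k. integral {0<..<real k} (?f k)) \<longlonglongrightarrow> integral {0<..} (\<lambda>y. y powr (a - 1) * exp (- (1 - \<rho>) * y))"
  proof (rule dominated_convergence_moving_domain[where h = h and K = 0])
    show "h integrable_on {0<..}"
      unfolding h_def using Gamma by (intro integrable_on_mult_right) (auto simp: has_integral_iff)
    show "h x \<ge> 0" for x by (simp add: h_def)
    show "\<bar>?f k y\<bar> \<le> h y" if "y \<in> {0<..<real k}" for k y
      using bound[OF that] by (simp only: real_norm_def)
    show "continuous_on {0<..<real k} (?f k)" for k
    proof -
      have ne: "1 - \<rho> * (y / real k) \<noteq> 0" if "y \<in> {0<..<real k}" for y
        using dens[of "y / real k"] that by simp
      show ?thesis by (intro continuous_intros) (use ne in auto)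
    qed
    fix y :: real
    assume y: "y \<in> {0<..}"
    show "\<forall>\<^sub>F k in sequentially. y \<in> {0<..<real k}"
      using eventually_gt_at_top[of "nat \<lceil>y\<rceil>"]
    proof eventually_elim
      case (elim k)
      then have "real (nat \<lceil>y\<rceil>) < real k" by simp
      then have "y < real k" by (rule le_less_trans[OF real_nat_ceiling_ge])
      then show ?case using y by simp
    qed
    have "(\<lambda>k. y powr (a - 1) * (1 - \<rho> * (y / real k)) powr - \<delta> *
        ((1 + (- y) / real k) ^ k / (1 + (- (\<rho> * y)) / real k) ^ k))
      \<longlonglongrightarrow> y powr (a - 1) * (1 - \<rho> * 0) powr - \<delta> * (exp (- y) / exp (- (\<rho> * y)))"
      by (intro tendsto_mult tendsto_divide tendsto_powr tendsto_diff tendsto_const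
          tendsto_exp_limit_sequentially lim_const_over_n) simp_all
    also have "exp (- y) / exp (- (\<rho> * y)) = exp (- (1 - \<rho>) * y)"
      by (simp add: algebra_simps flip: exp_diff)
    finally show "(\<lambda>k. ?f k y) \<longlonglongrightarrow> y powr (a - 1) * exp (- (1 - \<rho>) * y)"
      by (simp add: power_divide)
  qed auto
  then show ?thesis using Gamma by (simp add: integral_unique)
qed

text \<open>With \<open>\<beta>\<close> the reciprocal of the rate gap and \<open>m = k\<close>, the
  power of \<open>s\<close> in the growth curve becomes \<open>y / k\<close>, the scale on which a
  \<open>k\<close>-th power has an exponential limit.\<close>

lemma integral_power_substitution:
  fixes f :: "real \<Rightarrow> real" and m \<beta> :: real
  assumes m: "m > 0" and \<beta>: "\<beta> > 0" and f: "f absolutely_integrable_on {0<..<1}"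
  shows "integral {0<..<1} f = integral {0<..<m} (\<lambda>y. \<beta> / m * (y / m) powr (\<beta> - 1) * f ((y / m) powr \<beta>))"
proof -
  let ?g = "\<lambda>y. (y / m) powr \<beta>"
  have img: "?g ` {0<..<m} = {0<..<1}"
  proof (intro equalityI subsetI)
    fix x assume "x \<in> ?g ` {0<..<m}"
    then obtain y where "0 < y" "y < m" "x = (y / m) powr \<beta>" by auto
    moreover have "(y / m) powr \<beta> < 1 powr \<beta>"
      by (rule powr_less_mono2) (use \<open>0 < y\<close> \<open>y < m\<close> \<beta> in auto)
    ultimately show "x \<in> {0<..<1}" by simp
  next
    fix x :: real
    assume x: "x \<in> {0<..<1}"
    then have "x powr (1 / \<beta>) < 1 powr (1 / \<beta>)"
      using \<beta> by (intro powr_less_mono2) auto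
    with x m \<beta> show "x \<in> ?g ` {0<..<m}"
      by (intro image_eqI[of _ _ "m * x powr (1 / \<beta>)"]) (auto simp: powr_powr)
  qed
  have der: "(?g has_field_derivative \<beta> / m * (y / m) powr (\<beta> - 1)) (at y)" if "y \<in> {0<..<m}" for y
    using that m by (auto intro!: derivative_eq_intros simp: powr_diff field_simps)
  have inj: "inj_on ?g {0<..<m}"
  proof (rule strict_mono_on_imp_inj_on, rule strict_mono_onI)
    fix x y assume "x \<in> {0<..<m}" "y \<in> {0<..<m}" "x < y"
    then show "?g x < ?g y"
      using m \<beta> by (intro powr_less_mono2 divide_strict_right_mono) auto
  qed
  have "integral {0<..<1} f = integral {0<..<m} (\<lambda>y. \<bar>\<beta> / m * (y / m) powr (\<beta> - 1)\<bar> * f (?g y))"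
    using integral_substitution(2)[OF _ der inj] f unfolding img by simp
  then show ?thesis using m \<beta> by simp
qed

section \<open>Explicit growth curves for unequal rates\<close>

context
  fixes a b :: real
  assumes ab: "a > 0" "b > 0"
begin

text \<open>Separation of variables: in \<open>t = - ln s\<close> the quotient
  \<open>(1 - q) / (a - b q)\<close> decays at rate \<open>a - b\<close> from its initial value
  \<open>1 / a\<close>, so it equals \<open>s powr (a - b) / a\<close>; solving for \<open>q\<close>
  gives the formula.\<close>

lemma growth_curve_supercritical:
  assumes "b < a"
  shows "growth_curve a b (\<lambda>s. a * (1 - s powr (a - b)) / (a - b * s powr (a - b)))"
proof -
  define l where "l = a - b"
  have l: "l > 0" "b = a - l" using assms by (auto simp: l_def)
  have x: "0 < s powr l" "s powr l \<le> 1" if "0 < s" "s \<le> 1" for s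
    using that l powr_mono2[of l s 1] by auto
  have den: "a - b * s powr l > 0" if "0 < s" "s \<le> 1" for s
  proof -
    have "b * s powr l \<le> b * 1" using x[OF that] ab by (intro mult_left_mono) auto
    then show ?thesis using assms by simp
  qed
  show ?thesis
    unfolding growth_curve_def l_def[symmetric]
  proof (intro conjI ballI)
    show "continuous_on {0<..1} (\<lambda>s. a * (1 - s powr l) / (a - b * s powr l))"
      using den by (intro continuous_intros) (auto simp: less_le)
    fix s :: real
    assume s: "s \<in> {0<..1}"
    show "0 \<le> a * (1 - s powr l) / (a - b * s powr l)"
      using x[of s] den[of s] s ab by (intro divide_nonneg_pos mult_nonneg_nonneg) auto
    have "b * s powr l < a * s powr l" using x[of s] s assms by simp
    then show "a * (1 - s powr l) / (a - b * s powr l) < 1"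
      using den[of s] s by (simp add: algebra_simps)
  next
    fix s :: real
    assume s: "s \<in> {0<..<1}"
    define X D where "X = s powr l" and "D = a - b * X"
    have D: "D > 0" using den[of s] s by (simp add: D_def X_def)
    have X': "((\<lambda>s. s powr l) has_real_derivative l * X / s) (at s)"
      using s by (auto intro!: derivative_eq_intros simp: X_def powr_diff)
    have "((\<lambda>s. a * (1 - s powr l) / (a - b * s powr l)) has_real_derivative
        (a * (0 - l * X / s) * D - a * (1 - X) * (0 - b * (l * X / s))) / (D * D)) (at s)"
      using DERIV_divide[OF DERIV_cmult[OF DERIV_diff[OF DERIV_const X'], of a 1]
          DERIV_diff[OF DERIV_const DERIV_cmult[OF X', of b], of a]] D
      by (simp add: D_def X_def)
    also have "(a * (0 - l * X / s) * D - a * (1 - X) * (0 - b * (l * X / s))) / (D * D) =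
        - ((1 - a * (1 - X) / D) * (a - b * (a * (1 - X) / D)) / s)"
    proof -
      have 1: "1 - a * (1 - X) / D = l * X / D"
        using D by (simp add: D_def l_def field_simps)
      have 2: "a - b * (a * (1 - X) / D) = a * l / D"
        using D by (simp add: l_def field_simps) (simp add: D_def algebra_simps)
      have 3: "a * (0 - l * X / s) * D - a * (1 - X) * (0 - b * (l * X / s)) = - (a * l * l * X / s)"
        unfolding D_def l_def by (simp add: divide_inverse algebra_simps)
      show ?thesis unfolding 1 2 3 by (simp add: mult_ac)
    qed
    finally show "((\<lambda>s. a * (1 - s powr l) / (a - b * s powr l)) has_real_derivative
      - ((1 - a * (1 - s powr l) / (a - b * s powr l)) *
          (a - b * (a * (1 - s powr l) / (a - b * s powr l))) / s)) (at s)"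
      by (simp add: D_def X_def)
  qed simp
qed

text \<open>The supercritical formula with numerator and denominator multiplied by
  \<open>s powr (b - a)\<close>, so that the exponent is positive and the limit \<open>a / b\<close>
  at \<open>s = 0\<close> is visible.\<close>

lemma growth_curve_subcritical:
  assumes "a < b"
  shows "growth_curve a b (\<lambda>s. a * (1 - s powr (b - a)) / (b - a * s powr (b - a)))"
proof -
  define l where "l = b - a"
  have l: "l > 0" using assms by (auto simp: l_def)
  have x: "0 < s powr l" "s powr l \<le> 1" if "0 < s" "s \<le> 1" for s
    using that l powr_mono2[of l s 1] by auto
  have den: "b - a * s powr l > 0" if "0 < s" "s \<le> 1" for s
  proof -
    have "a * s powr l \<le> a * 1" using x[OF that] ab by (intro mult_left_mono) auto
    then show ?thesis using assms by simp
  qed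
  show ?thesis
    unfolding growth_curve_def l_def[symmetric]
  proof (intro conjI ballI)
    show "continuous_on {0<..1} (\<lambda>s. a * (1 - s powr l) / (b - a * s powr l))"
      using den by (intro continuous_intros) (auto simp: less_le)
    fix s :: real
    assume s: "s \<in> {0<..1}"
    show "0 \<le> a * (1 - s powr l) / (b - a * s powr l)"
      using x[of s] den[of s] s ab by (intro divide_nonneg_pos mult_nonneg_nonneg) auto
    show "a * (1 - s powr l) / (b - a * s powr l) < 1"
      using den[of s] s assms by (simp add: algebra_simps)
  next
    fix s :: real
    assume s: "s \<in> {0<..<1}"
    define X D where "X = s powr l" and "D = b - a * X"
    have D: "D > 0" using den[of s] s by (simp add: D_def X_def)
    have X': "((\<lambda>s. s powr l) has_real_derivative l * X / s) (at s)"
      using s by (auto intro!: derivative_eq_intros simp: X_def powr_diff)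
    have "((\<lambda>s. a * (1 - s powr l) / (b - a * s powr l)) has_real_derivative
        (a * (0 - l * X / s) * D - a * (1 - X) * (0 - a * (l * X / s))) / (D * D)) (at s)"
      using DERIV_divide[OF DERIV_cmult[OF DERIV_diff[OF DERIV_const X'], of a 1]
          DERIV_diff[OF DERIV_const DERIV_cmult[OF X', of a], of b]] D
      by (simp add: D_def X_def)
    also have "(a * (0 - l * X / s) * D - a * (1 - X) * (0 - a * (l * X / s))) / (D * D) =
        - ((1 - a * (1 - X) / D) * (a - b * (a * (1 - X) / D)) / s)"
    proof -
      have 1: "1 - a * (1 - X) / D = l / D"
        using D by (simp add: D_def l_def field_simps)
      have 2: "a - b * (a * (1 - X) / D) = a * l * X / D"
        using D by (simp add: l_def field_simps) (simp add: D_def algebra_simps)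
      have 3: "a * (0 - l * X / s) * D - a * (1 - X) * (0 - a * (l * X / s)) = - (a * l * l * X / s)"
        unfolding D_def l_def by (simp add: divide_inverse algebra_simps)
      show ?thesis unfolding 1 2 3 by (simp add: mult_ac)
    qed
    finally show "((\<lambda>s. a * (1 - s powr l) / (b - a * s powr l)) has_real_derivative
      - ((1 - a * (1 - s powr l) / (b - a * s powr l)) *
          (a - b * (a * (1 - s powr l) / (b - a * s powr l))) / s)) (at s)"
      by (simp add: D_def X_def)
  qed simp
qed

end

section \<open>The power law and the geometric regime\<close>

context
  fixes a b \<delta> :: real
  assumes ab: "a > 0" "b > 0" and \<delta>: "\<delta> > 0"
begin

text \<open>With \<open>x = y / k\<close>, the factor \<open>(1 - q) powr \<delta>\<close>
  contributes \<open>x powr \<delta>\<close> and the Jacobian \<open>x powr (\<beta> - 1)\<close>.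
  Hence the Gamma argument \<open>\<delta> + \<beta>\<close>, and the order
  \<open>k powr - (\<beta> + \<delta>)\<close> times \<open>k powr (\<delta> - 1)\<close> from the
  coefficient.\<close>

lemma mixture_supercritical:
  assumes ba: "b < a"
  shows "(\<lambda>k. neg_binomial_mixture \<delta> (\<lambda>s. a * (1 - s powr (a - b)) / (a - b * s powr (a - b))) k
      * real k powr (1 / (a - b) + 1))
    \<longlonglongrightarrow> (a - b) powr (- (1 / (a - b) + 1)) * a powr (1 / (a - b)) * Gamma (\<delta> + 1 / (a - b)) / Gamma \<delta>"
proof -
  define l \<beta> \<rho> where "l = a - b" and "\<beta> = 1 / l" and "\<rho> = b / a"
  have l: "l > 0" using ba by (simp add: l_def)
  then have \<beta>: "\<beta> > 0" "\<beta> * l = 1" by (auto simp: \<beta>_def)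
  have \<rho>: "0 \<le> \<rho>" "\<rho> < 1" "1 - \<rho> = l / a" using ab ba by (auto simp: \<rho>_def l_def field_simps)
  let ?q = "\<lambda>s. a * (1 - s powr l) / (a - b * s powr l)"
  let ?C = "\<lambda>k. pochhammer \<delta> k / fact k :: real"
  let ?J = "\<lambda>k. integral {0<..<real k} (\<lambda>y. y powr (\<beta> + \<delta> - 1) * (1 - \<rho> * (y / real k)) powr - \<delta> *
    ((1 - y / real k) / (1 - \<rho> * (y / real k))) ^ k)"
  have J: "?J \<longlonglongrightarrow> Gamma (\<beta> + \<delta>) * (1 - \<rho>) powr - (\<beta> + \<delta>)"
    using \<rho> \<beta> \<delta> by (intro rational_kernel_limit) auto
  have eq: "neg_binomial_mixture \<delta> ?q k * real k powr (\<beta> + 1) =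
      (?C k * real k powr (1 - \<delta>)) * ((1 - \<rho>) powr \<delta> * \<beta>) * ?J k" if k: "k > 0" for k
  proof -
    have "neg_binomial_mixture \<delta> ?q k =
        integral {0<..<real k} (\<lambda>y. \<beta> / real k * (y / real k) powr (\<beta> - 1) * neg_binomial \<delta> k (?q ((y / real k) powr \<beta>)))"
      unfolding neg_binomial_mixture_def
      using neg_binomial_mixture_absolutely_integrable[OF \<delta> growth_curve_supercritical[OF ab ba]] k \<beta>
      by (intro integral_power_substitution) (auto simp: l_def)
    also have "\<dots> = integral {0<..<real k} (\<lambda>y. (?C k * (1 - \<rho>) powr \<delta> * \<beta> * real k powr - (\<beta> + \<delta>)) *
      (y powr (\<beta> + \<delta> - 1) * (1 - \<rho> * (y / real k)) powr - \<delta> *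
        ((1 - y / real k) / (1 - \<rho> * (y / real k))) ^ k))"
    proof (rule integral_cong)
      fix y assume y: "y \<in> {0<..<real k}"
      define x where "x = y / real k"
      have x: "0 < x" "x < 1" "y = x * real k" using y by (auto simp: x_def)
      have den: "1 - \<rho> * x > 0" using mult_strict_mono'[of \<rho> 1 x 1] x \<rho> by simp
      show "\<beta> / real k * (y / real k) powr (\<beta> - 1) * neg_binomial \<delta> k (?q ((y / real k) powr \<beta>)) =
        (?C k * (1 - \<rho>) powr \<delta> * \<beta> * real k powr - (\<beta> + \<delta>)) *
        (y powr (\<beta> + \<delta> - 1) * (1 - \<rho> * (y / real k)) powr - \<delta> *
          ((1 - y / real k) / (1 - \<rho> * (y / real k))) ^ k)"
      proof -
        have "a - b * x = a * (1 - \<rho> * x)" using ab by (simp add: \<rho>_def algebra_simps)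
        then have q: "?q (x powr \<beta>) = (1 - x) / (1 - \<rho> * x)"
          using ab x \<beta> by (simp add: powr_powr)
        have "1 - (1 - x) / (1 - \<rho> * x) = (1 - \<rho>) * x / (1 - \<rho> * x)"
          using den by (simp add: field_simps)
        then have p: "(1 - (1 - x) / (1 - \<rho> * x)) powr \<delta> = (1 - \<rho>) powr \<delta> * x powr \<delta> * (1 - \<rho> * x) powr - \<delta>"
          using den x \<rho>(1,2) by (simp add: powr_mult powr_divide powr_minus_divide)
        have y': "real k powr - (\<beta> + \<delta>) * y powr (\<beta> + \<delta> - 1) = x powr (\<beta> - 1) * x powr \<delta> / real k"
          using k x by (simp add: powr_mult powr_diff powr_add powr_minus field_simps)
        have "\<beta> / real k * x powr (\<beta> - 1) * neg_binomial \<delta> k (?q (x powr \<beta>)) =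
            ?C k * (1 - \<rho>) powr \<delta> * \<beta> * (x powr (\<beta> - 1) * x powr \<delta> / real k) *
            ((1 - \<rho> * x) powr - \<delta> * ((1 - x) / (1 - \<rho> * x)) ^ k)"
          unfolding neg_binomial_def q p by (simp only: divide_inverse mult_ac)
        then show ?thesis unfolding y'[symmetric] x_def[symmetric] by (simp only: mult_ac)
      qed
    qed
    also have "\<dots> = ?C k * (1 - \<rho>) powr \<delta> * \<beta> * real k powr - (\<beta> + \<delta>) * ?J k"
      by (rule integral_mult_right)
    finally have mix: "neg_binomial_mixture \<delta> ?q k = ?C k * (1 - \<rho>) powr \<delta> * \<beta> * real k powr - (\<beta> + \<delta>) * ?J k" .
    have pw: "real k powr - (\<beta> + \<delta>) * real k powr (\<beta> + 1) = real k powr (1 - \<delta>)"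
      unfolding powr_add[symmetric] by (rule arg_cong[of _ _ "(powr) (real k)"]) simp
    show ?thesis unfolding mix pw[symmetric] by (simp only: mult_ac)
  qed
  have "(\<lambda>k. (?C k * real k powr (1 - \<delta>)) * ((1 - \<rho>) powr \<delta> * \<beta>) * ?J k) \<longlonglongrightarrow>
      1 / Gamma \<delta> * ((1 - \<rho>) powr \<delta> * \<beta>) * (Gamma (\<beta> + \<delta>) * (1 - \<rho>) powr - (\<beta> + \<delta>))"
    by (intro tendsto_mult neg_binomial_coeff_asymp J tendsto_const \<delta>)
  then have "(\<lambda>k. neg_binomial_mixture \<delta> ?q k * real k powr (\<beta> + 1)) \<longlonglongrightarrow>
      1 / Gamma \<delta> * ((1 - \<rho>) powr \<delta> * \<beta>) * (Gamma (\<beta> + \<delta>) * (1 - \<rho>) powr - (\<beta> + \<delta>))"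
    by (rule Lim_transform_eventually[OF _ eventually_mono[OF eventually_gt_at_top[of 0]]]) (rule eq[symmetric])
  also have "1 / Gamma \<delta> * ((1 - \<rho>) powr \<delta> * \<beta>) * (Gamma (\<beta> + \<delta>) * (1 - \<rho>) powr - (\<beta> + \<delta>)) =
      ((1 - \<rho>) powr \<delta> * (1 - \<rho>) powr - (\<beta> + \<delta>) * \<beta>) * Gamma (\<delta> + \<beta>) / Gamma \<delta>"
    by (simp add: add.commute)
  also have "(1 - \<rho>) powr \<delta> * (1 - \<rho>) powr - (\<beta> + \<delta>) = (l / a) powr - \<beta>"
    unfolding \<rho>(3) powr_add[symmetric] by (rule arg_cong[of _ _ "(powr) (l / a)"]) simp
  also have "(l / a) powr - \<beta> * \<beta> = l powr (- \<beta> - 1) * a powr \<beta>"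
    using l by (simp add: powr_divide powr_minus_divide powr_diff \<beta>_def)
  also have "- \<beta> - 1 = - (\<beta> + 1)" by simp
  finally show ?thesis by (simp only: \<beta>_def l_def)
qed

text \<open>Here \<open>1 - q\<close> tends to \<open>1 - \<rho> > 0\<close> as \<open>s\<close>
  tends to \<open>0\<close>, so only the Jacobian contributes a power of \<open>x\<close>: the Gamma
  argument is \<open>\<beta>\<close> alone. The limit \<open>\<rho>\<close> of \<open>q\<close>
  splits off as \<open>\<rho> ^ k\<close>.\<close>

lemma mixture_subcritical:
  assumes ab': "a < b"
  shows "(\<lambda>k. neg_binomial_mixture \<delta> (\<lambda>s. a * (1 - s powr (b - a)) / (b - a * s powr (b - a))) k
      / ((a / b) ^ k * real k powr (\<delta> - 1 / (b - a) - 1)))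
    \<longlonglongrightarrow> (b - a) powr (\<delta> - 1 / (b - a) - 1) * b powr (1 / (b - a) - \<delta>) * Gamma (1 / (b - a)) / Gamma \<delta>"
proof -
  define l \<beta> \<rho> where "l = b - a" and "\<beta> = 1 / l" and "\<rho> = a / b"
  have l: "l > 0" using ab' by (simp add: l_def)
  then have \<beta>: "\<beta> > 0" "\<beta> * l = 1" by (auto simp: \<beta>_def)
  have \<rho>: "0 < \<rho>" "\<rho> < 1" "1 - \<rho> = l / b" using ab ab' by (auto simp: \<rho>_def l_def field_simps)
  let ?q = "\<lambda>s. a * (1 - s powr l) / (b - a * s powr l)"
  let ?C = "\<lambda>k. pochhammer \<delta> k / fact k :: real"
  let ?J = "\<lambda>k. integral {0<..<real k} (\<lambda>y. y powr (\<beta> - 1) * (1 - \<rho> * (y / real k)) powr - \<delta> *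
    ((1 - y / real k) / (1 - \<rho> * (y / real k))) ^ k)"
  have J: "?J \<longlonglongrightarrow> Gamma \<beta> * (1 - \<rho>) powr - \<beta>"
    using \<rho> \<beta> \<delta> by (intro rational_kernel_limit) auto
  have eq: "neg_binomial_mixture \<delta> ?q k / (\<rho> ^ k * real k powr (\<delta> - \<beta> - 1)) =
      (?C k * real k powr (1 - \<delta>)) * ((1 - \<rho>) powr \<delta> * \<beta>) * ?J k" if k: "k > 0" for k
  proof -
    have "neg_binomial_mixture \<delta> ?q k =
        integral {0<..<real k} (\<lambda>y. \<beta> / real k * (y / real k) powr (\<beta> - 1) * neg_binomial \<delta> k (?q ((y / real k) powr \<beta>)))"
      unfolding neg_binomial_mixture_def
      using neg_binomial_mixture_absolutely_integrable[OF \<delta> growth_curve_subcritical[OF ab ab']] k \<beta>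
      by (intro integral_power_substitution) (auto simp: l_def)
    also have "\<dots> = integral {0<..<real k} (\<lambda>y. (?C k * (1 - \<rho>) powr \<delta> * \<beta> * real k powr - \<beta> * \<rho> ^ k) *
      (y powr (\<beta> - 1) * (1 - \<rho> * (y / real k)) powr - \<delta> *
        ((1 - y / real k) / (1 - \<rho> * (y / real k))) ^ k))"
    proof (rule integral_cong)
      fix y assume y: "y \<in> {0<..<real k}"
      define x where "x = y / real k"
      have x: "0 < x" "x < 1" "y = x * real k" using y by (auto simp: x_def)
      have den: "1 - \<rho> * x > 0" using mult_strict_mono'[of \<rho> 1 x 1] x \<rho> by simp
      show "\<beta> / real k * (y / real k) powr (\<beta> - 1) * neg_binomial \<delta> k (?q ((y / real k) powr \<beta>)) =
        (?C k * (1 - \<rho>) powr \<delta> * \<beta> * real k powr - \<beta> * \<rho> ^ k) *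
        (y powr (\<beta> - 1) * (1 - \<rho> * (y / real k)) powr - \<delta> *
          ((1 - y / real k) / (1 - \<rho> * (y / real k))) ^ k)"
      proof -
        have "b - a * x = b * (1 - \<rho> * x)" using ab by (simp add: \<rho>_def algebra_simps)
        then have q: "?q (x powr \<beta>) = \<rho> * ((1 - x) / (1 - \<rho> * x))"
          using ab x \<beta> by (simp add: powr_powr \<rho>_def)
        have "1 - \<rho> * ((1 - x) / (1 - \<rho> * x)) = (1 - \<rho>) / (1 - \<rho> * x)"
          using den by (simp add: field_simps)
        then have p: "(1 - \<rho> * ((1 - x) / (1 - \<rho> * x))) powr \<delta> = (1 - \<rho>) powr \<delta> * (1 - \<rho> * x) powr - \<delta>"
          using den x \<rho>(1,2) by (simp add: powr_mult powr_divide powr_minus_divide)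
        have y': "real k powr - \<beta> * y powr (\<beta> - 1) = x powr (\<beta> - 1) / real k"
          using k x by (simp add: powr_mult powr_diff powr_add powr_minus field_simps)
        have "\<beta> / real k * x powr (\<beta> - 1) * neg_binomial \<delta> k (?q (x powr \<beta>)) =
            ?C k * (1 - \<rho>) powr \<delta> * \<beta> * (x powr (\<beta> - 1) / real k) * \<rho> ^ k *
            ((1 - \<rho> * x) powr - \<delta> * ((1 - x) / (1 - \<rho> * x)) ^ k)"
          unfolding neg_binomial_def q p power_mult_distrib[of \<rho>] by (simp only: divide_inverse mult_ac)
        then show ?thesis unfolding y'[symmetric] x_def[symmetric] by (simp only: mult_ac)
      qed
    qed
    also have "\<dots> = ?C k * (1 - \<rho>) powr \<delta> * \<beta> * real k powr - \<beta> * \<rho> ^ k * ?J k"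
      by (rule integral_mult_right)
    finally have mix: "neg_binomial_mixture \<delta> ?q k = ?C k * (1 - \<rho>) powr \<delta> * \<beta> * real k powr - \<beta> * \<rho> ^ k * ?J k" .
    have "real k powr - \<beta> = real k powr (1 - \<delta>) * real k powr (\<delta> - \<beta> - 1)"
      unfolding powr_add[symmetric] by (rule arg_cong[of _ _ "(powr) (real k)"]) simp
    then show ?thesis unfolding mix using \<rho>(1) k by simp
  qed
  have "(\<lambda>k. (?C k * real k powr (1 - \<delta>)) * ((1 - \<rho>) powr \<delta> * \<beta>) * ?J k) \<longlonglongrightarrow>
      1 / Gamma \<delta> * ((1 - \<rho>) powr \<delta> * \<beta>) * (Gamma \<beta> * (1 - \<rho>) powr - \<beta>)"
    by (intro tendsto_mult neg_binomial_coeff_asymp J tendsto_const \<delta>)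
  then have "(\<lambda>k. neg_binomial_mixture \<delta> ?q k / (\<rho> ^ k * real k powr (\<delta> - \<beta> - 1))) \<longlonglongrightarrow>
      1 / Gamma \<delta> * ((1 - \<rho>) powr \<delta> * \<beta>) * (Gamma \<beta> * (1 - \<rho>) powr - \<beta>)"
    by (rule Lim_transform_eventually[OF _ eventually_mono[OF eventually_gt_at_top[of 0]]]) (rule eq[symmetric])
  also have "1 / Gamma \<delta> * ((1 - \<rho>) powr \<delta> * \<beta>) * (Gamma \<beta> * (1 - \<rho>) powr - \<beta>) =
      ((1 - \<rho>) powr \<delta> * (1 - \<rho>) powr - \<beta> * \<beta>) * Gamma \<beta> / Gamma \<delta>"
    by simp
  also have "(1 - \<rho>) powr \<delta> * (1 - \<rho>) powr - \<beta> = (l / b) powr (\<delta> - \<beta>)"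
    unfolding \<rho>(3) powr_add[symmetric] by (rule arg_cong[of _ _ "(powr) (l / b)"]) simp
  also have "(l / b) powr (\<delta> - \<beta>) * \<beta> = l powr (\<delta> - \<beta> - 1) * b powr - (\<delta> - \<beta>)"
    using l by (simp only: powr_divide powr_minus_divide powr_diff[of l "\<delta> - \<beta>" 1]) (simp add: \<beta>_def)
  also have "- (\<delta> - \<beta>) = \<beta> - \<delta>" by simp
  finally show ?thesis by (simp only: \<beta>_def l_def \<rho>_def)
qed

end

text \<open>The drift \<open>a (1 - q)^2\<close> has a double root, so
  \<open>1 / (1 - q) = 1 + a t\<close> grows linearly in the age \<open>t = - ln s\<close>.\<close>

lemma growth_curve_critical:
  fixes a :: real
  assumes a: "a > 0"
  shows "growth_curve a a (\<lambda>s. 1 - 1 / (1 - a * ln s))"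
proof -
  have u: "1 - a * ln s \<ge> 1" if "0 < s" "s \<le> 1" for s
    using that a by (simp add: mult_nonneg_nonpos)
  show ?thesis
    unfolding growth_curve_def
  proof (intro conjI ballI)
    have ne: "1 - a * ln s \<noteq> 0" if "s \<in> {0<..1}" for s using u[of s] that by auto
    show "continuous_on {0<..1} (\<lambda>s. 1 - 1 / (1 - a * ln s))"
      by (intro continuous_intros) (use ne in auto)
    fix s :: real
    assume s: "s \<in> {0<..1}"
    then have "1 - a * ln s \<ge> 1" using u by simp
    then show "0 \<le> 1 - 1 / (1 - a * ln s)" "1 - 1 / (1 - a * ln s) < 1" by simp_all
  next
    fix s :: real
    assume s: "s \<in> {0<..<1}"
    then have "1 - a * ln s \<noteq> 0" using u[of s] by auto
    then show "((\<lambda>s. 1 - 1 / (1 - a * ln s)) has_real_derivative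
      - ((1 - (1 - 1 / (1 - a * ln s))) * (a - a * (1 - 1 / (1 - a * ln s))) / s)) (at s)"
      using s by (auto intro!: derivative_eq_intros simp: field_simps)
  qed simp
qed

section \<open>Saddle point analysis for equal rates\<close>

lemma has_integral_gaussian:
  assumes "\<sigma> > 0"
  shows "((\<lambda>x :: real. exp (- x\<^sup>2 / (2 * \<sigma>\<^sup>2))) has_integral sqrt (2 * pi * \<sigma>\<^sup>2)) UNIV"
proof -
  have "(normal_density 0 \<sigma> has_integral 1) UNIV"
    using has_integral_integral_lborel[OF integrable_normal_density[OF assms, of 0]] assms by simp
  from has_integral_mult_right[OF this, of "sqrt (2 * pi * \<sigma>\<^sup>2)"] show ?thesis
    using assms by (simp add: normal_density_def)
qed

text \<open>By integrating \<open>1 \<le> cosh\<close> twice; it dominates the saddle factor by a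
  Gaussian.\<close>

lemma cosh_ge_quadratic: "1 + x\<^sup>2 / 2 \<le> cosh (x :: real)"
proof -
  have *: "1 + x\<^sup>2 / 2 \<le> cosh x" if "x \<ge> 0" for x :: real
  proof -
    have sinh: "z \<le> sinh z" if "z \<ge> 0" for z :: real
    proof -
      have "sinh 0 - 0 \<le> sinh z - z"
        by (rule DERIV_nonneg_imp_nondecreasing[OF that])
          (auto intro!: exI derivative_eq_intros cosh_real_ge_1)
      then show ?thesis by simp
    qed
    have "cosh 0 - (1 + 0\<^sup>2 / 2) \<le> cosh x - (1 + x\<^sup>2 / 2)"
      by (rule DERIV_nonneg_imp_nondecreasing[OF that])
        (auto intro!: exI derivative_eq_intros sinh)
    then show ?thesis by simp
  qed
  show ?thesis using *[of x] *[of "- x"] by (cases "x \<ge> 0") auto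
qed

text \<open>As \<open>m^2 = \<mu>\<close>, the factor with \<open>cosh\<close> tends to
  \<open>exp (- y^2)\<close>. The last factor is \<open>exp (- k x^2 / 2)\<close> to leading order
  with \<open>x = 1 / u\<close>, and \<open>k x^2\<close> tends to \<open>1 / a\<close>, which
  explains the constant \<open>exp (- 1 / (2 * a))\<close>. The tilt by \<open>c\<close> disappears
  in the limit.\<close>

lemma saddle_integral_limit:
  fixes a c :: real
  assumes a: "a > 0"
  defines "\<mu> \<equiv> \<lambda>k :: nat. sqrt (real k / a)" and "m \<equiv> \<lambda>k :: nat. sqrt (sqrt (real k / a))"
  defines "u \<equiv> \<lambda>k y. a * \<mu> k * exp (y / m k)"
  shows "(\<lambda>k. integral {- m k * ln (a * \<mu> k)<..} (\<lambda>y. exp (c * (y / m k)) *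
      exp (- 2 * \<mu> k * (cosh (y / m k) - 1)) * ((1 - 1 / u k y) * exp (1 / u k y)) ^ k))
    \<longlonglongrightarrow> sqrt pi * exp (- 1 / (2 * a))"
    (is "(\<lambda>k. integral (?S k) (?f k)) \<longlonglongrightarrow> _")
proof -
  \<comment> \<open>Half of the Gaussian exponent is spent on absorbing the tilt:
    \<open>c y \<le> c^2 / 2 + y^2 / 2\<close>.\<close>
  define h where "h = (\<lambda>y. exp (c\<^sup>2 / 2) * exp (- y\<^sup>2 / (2 * 1\<^sup>2)))"
  \<comment> \<open>From \<open>K\<close> on, \<open>k \<ge> a\<close> and so
    \<open>m k \<ge> 1\<close>, which bounds \<open>c * (y / m k)\<close> by
    \<open>\<bar>c * y\<bar>\<close>.\<close>
  define K where "K = Suc (nat \<lceil>a\<rceil>)"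
  have pos: "\<mu> k > 0" "m k > 0" "(m k)\<^sup>2 = \<mu> k" "real k = a * (\<mu> k)\<^sup>2" if "k > 0" for k
    using a that by (auto simp: \<mu>_def m_def)
  have K: "k > 0" "m k \<ge> 1" if "k \<ge> K" for k
  proof -
    show "k > 0" using that by (simp add: K_def)
    have "a \<le> real (nat \<lceil>a\<rceil>)" by (rule real_nat_ceiling_ge)
    also have "\<dots> \<le> real k" using that unfolding K_def of_nat_le_iff by linarith
    finally show "m k \<ge> 1" using a by (simp add: m_def)
  qed
  \<comment> \<open>The lower endpoint corresponds to \<open>s = 1\<close>, that is to
    \<open>u = 1\<close>, so \<open>1 / u k y\<close> stays in \<open>(0, 1)\<close>.\<close>
  have u1: "u k y > 1" if "k > 0" "y \<in> ?S k" for k y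
  proof -
    have "- ln (a * \<mu> k) < y / m k" using that pos[OF that(1)] by (simp add: field_simps)
    then have "exp (- ln (a * \<mu> k)) < exp (y / m k)" by simp
    then show ?thesis using pos[OF that(1)] a by (simp add: u_def exp_minus field_simps)
  qed
  have m_lim: "filterlim m at_top sequentially"
    unfolding m_def using a by real_asymp
  have \<mu>_lim: "filterlim \<mu> at_top sequentially"
    unfolding \<mu>_def using a by real_asymp
  have theta: "(\<lambda>k. y / m k) \<longlonglongrightarrow> 0" for y
    by (rule tendsto_divide_0[OF tendsto_const filterlim_at_top_imp_at_infinity[OF m_lim]])
  have u_lim: "filterlim (\<lambda>k. u k y) at_top sequentially" for y
  proof -
    have "(\<lambda>k. a * exp (y / m k)) \<longlonglongrightarrow> a * exp 0"
      by (intro tendsto_intros theta)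
    then have "filterlim (\<lambda>k. a * exp (y / m k) * \<mu> k) at_top sequentially"
      by (rule filterlim_tendsto_pos_mult_at_top[OF _ _ \<mu>_lim]) (use a in simp)
    then show ?thesis by (simp add: u_def mult_ac)
  qed
  have gauss: "((\<lambda>y :: real. exp (- y\<^sup>2)) has_integral sqrt pi) UNIV"
    using has_integral_gaussian[of "1 / sqrt 2"] by (simp add: power_divide)
  have "(\<lambda>k. integral (?S k) (?f k)) \<longlonglongrightarrow> integral UNIV (\<lambda>y. exp (- y\<^sup>2) * exp (- 1 / (2 * a)))"
  proof (rule dominated_convergence_moving_domain[where h = h and K = K])
    show "h integrable_on UNIV"
      unfolding h_def using has_integral_gaussian[of 1]
      by (intro integrable_on_mult_right) (auto simp: has_integral_iff)
    show "h x \<ge> 0" for x by (simp add: h_def)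
    show "continuous_on (?S k) (?f k)" if "k \<ge> K" for k
    proof -
      have "u k y \<noteq> 0" for y using pos[OF K(1)[OF that]] a by (simp add: u_def)
      moreover have "continuous_on (?S k) (u k)"
        unfolding u_def by (intro continuous_intros) (use pos[OF K(1)[OF that]] in auto)
      ultimately show ?thesis
        by (intro continuous_intros) (use pos[OF K(1)[OF that]] in auto)
    qed
    show "\<bar>?f k y\<bar> \<le> h y" if k: "k \<ge> K" and y: "y \<in> ?S k" for k y
    proof -
      note p = pos[OF K(1)[OF k]]
      define x where "x = 1 / u k y"
      have x: "0 < x" "x < 1" using u1[OF K(1)[OF k] y] by (auto simp: x_def)
      have "(1 - x) * exp x \<le> exp (- x) * exp x"
        using exp_ge_add_one_self[of "- x"] by (intro mult_right_mono) auto
      then have "(1 - x) * exp x \<le> 1" by (simp flip: exp_add)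
      then have 1: "((1 - x) * exp x) ^ k \<le> 1" using x by (intro power_le_one) auto
      have 2: "((1 - x) * exp x) ^ k \<ge> 0" using x by simp
      have "\<mu> k * (y / m k)\<^sup>2 = y\<^sup>2"
        using p(1,2) unfolding p(3)[symmetric] by (simp add: power_divide)
      moreover have "2 * \<mu> k * ((y / m k)\<^sup>2 / 2) \<le> 2 * \<mu> k * (cosh (y / m k) - 1)"
        using cosh_ge_quadratic[of "y / m k"] p by (intro mult_left_mono) auto
      ultimately have 3: "y\<^sup>2 \<le> 2 * \<mu> k * (cosh (y / m k) - 1)" by simp
      have "c * (y / m k) \<le> \<bar>c * y\<bar> / m k" using p by (simp add: divide_right_mono)
      also have "\<dots> \<le> \<bar>c * y\<bar>" using K(2)[OF k] by (simp add: divide_le_eq mult_right_le_one_le mult_le_cancel_left1)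
      also have "\<bar>c * y\<bar> \<le> c\<^sup>2 / 2 + y\<^sup>2 / 2"
        using zero_le_power2[of "\<bar>c\<bar> - \<bar>y\<bar>"] by (simp add: power2_diff abs_mult)
      finally have "c * (y / m k) + - 2 * \<mu> k * (cosh (y / m k) - 1) \<le> c\<^sup>2 / 2 + - y\<^sup>2 / 2"
        using 3 by simp
      then have "exp (c * (y / m k)) * exp (- 2 * \<mu> k * (cosh (y / m k) - 1)) \<le> h y"
        by (simp add: h_def flip: exp_add)
      then have "exp (c * (y / m k)) * exp (- 2 * \<mu> k * (cosh (y / m k) - 1)) * ((1 - x) * exp x) ^ k \<le> h y * 1"
        using 1 2 by (intro mult_mono) (auto simp: h_def)
      then show ?thesis unfolding x_def[symmetric] using 2 by (simp add: abs_mult)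
    qed
    fix y :: real
    show "\<forall>\<^sub>F k in sequentially. y \<in> ?S k"
      using filterlim_at_top_dense[THEN iffD1, OF u_lim, rule_format, of 1 y] eventually_gt_at_top[of 0]
    proof eventually_elim
      case (elim k)
      note p = pos[OF elim(2)]
      have "ln 1 < ln (u k y)" using elim by (subst ln_less_cancel_iff) auto
      then have "- ln (a * \<mu> k) < y / m k" using p a by (simp add: u_def ln_mult)
      then show ?case using p by (simp add: field_simps)
    qed
    show "(\<lambda>k. ?f k y) \<longlonglongrightarrow> exp (- y\<^sup>2) * exp (- 1 / (2 * a))"
    proof -
      have "(\<lambda>k. exp (c * (y / m k))) \<longlonglongrightarrow> exp (c * 0)"
        by (intro tendsto_intros theta)
      moreover have "(\<lambda>k. exp (- 2 * \<mu> k * (cosh (y / m k) - 1))) \<longlonglongrightarrow> exp (- y\<^sup>2)"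
      \<comment> \<open>The limit of \<open>(cosh x - 1) / x^2\<close> is taken along a punctured
        neighbourhood of \<open>0\<close>, so \<open>x = y / m k\<close> must be nonzero.\<close>
      proof (cases "y = 0")
        case False
        have "\<forall>\<^sub>F k in sequentially. y / m k \<noteq> 0"
          using eventually_gt_at_top[of 0] by eventually_elim (simp add: False less_imp_neq[OF pos(2), symmetric])
        then have "filterlim (\<lambda>k. y / m k) (at 0) sequentially"
          by (intro filterlim_atI theta)
        moreover have "((\<lambda>x :: real. (cosh x - 1) / x\<^sup>2) \<longlongrightarrow> 1 / 2) (at 0)" by real_asymp
        ultimately have "(\<lambda>k. (cosh (y / m k) - 1) / (y / m k)\<^sup>2) \<longlonglongrightarrow> 1 / 2"
          by (rule filterlim_compose[rotated])
        then have "(\<lambda>k. exp (- 2 * y\<^sup>2 * ((cosh (y / m k) - 1) / (y / m k)\<^sup>2))) \<longlonglongrightarrow> exp (- 2 * y\<^sup>2 * (1 / 2))"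
          by (intro tendsto_exp tendsto_mult tendsto_const)
        moreover have "\<forall>\<^sub>F k in sequentially. exp (- 2 * y\<^sup>2 * ((cosh (y / m k) - 1) / (y / m k)\<^sup>2)) =
            exp (- 2 * \<mu> k * (cosh (y / m k) - 1))"
          using eventually_gt_at_top[of 0]
        proof eventually_elim
          case (elim k)
          then show ?case using pos(2)[OF elim] False unfolding pos(3)[OF elim, symmetric]
            by (simp add: field_simps)
        qed
        ultimately show ?thesis by (simp add: Lim_transform_eventually)
      qed simp
      moreover have "(\<lambda>k. ((1 - 1 / u k y) * exp (1 / u k y)) ^ k) \<longlonglongrightarrow> exp (- 1 / (2 * a))"
      proof -
        let ?x = "\<lambda>k. 1 / u k y"
        have u_ev: "\<forall>\<^sub>F k in sequentially. u k y > 1"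
          using u_lim by (simp add: filterlim_at_top_dense)
        have "filterlim ?x (at_right 0) sequentially"
          using filterlim_compose[OF filterlim_inverse_at_right_top u_lim] by (simp add: inverse_eq_divide)
        moreover have "((\<lambda>x :: real. (ln (1 - x) + x) / x\<^sup>2) \<longlongrightarrow> - 1 / 2) (at_right 0)" by real_asymp
        ultimately have "(\<lambda>k. (ln (1 - ?x k) + ?x k) / (?x k)\<^sup>2) \<longlonglongrightarrow> - 1 / 2"
          by (rule filterlim_compose[rotated])
        then have "(\<lambda>k. exp (1 / a * exp (- 2 * (y / m k)) * ((ln (1 - ?x k) + ?x k) / (?x k)\<^sup>2))) \<longlonglongrightarrow>
            exp (1 / a * exp (- 2 * 0) * (- 1 / 2))"
          by (intro tendsto_exp tendsto_mult tendsto_const theta)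
        moreover have "\<forall>\<^sub>F k in sequentially.
            exp (1 / a * exp (- 2 * (y / m k)) * ((ln (1 - ?x k) + ?x k) / (?x k)\<^sup>2)) = ((1 - ?x k) * exp (?x k)) ^ k"
          using u_ev eventually_gt_at_top[of 0]
        proof eventually_elim
          case (elim k)
          define x where "x = ?x k"
          have x: "0 < x" "x < 1" using elim by (auto simp: x_def)
          have kx: "real k * x\<^sup>2 = 1 / a * exp (- 2 * (y / m k))"
          proof -
            have "exp (- 2 * (y / m k)) = 1 / (exp (y / m k))\<^sup>2"
              by (simp add: exp_minus inverse_eq_divide flip: exp_double)
            then show ?thesis
              using pos[OF elim(2)] a by (simp add: x_def u_def power2_eq_square)
          qed
          have "1 / a * exp (- 2 * (y / m k)) * ((ln (1 - x) + x) / x\<^sup>2) = real k * (ln (1 - x) + x)"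
            unfolding kx[symmetric] using x by simp
          also have "exp \<dots> = ((1 - x) * exp x) ^ k"
            using x by (simp add: exp_of_nat_mult exp_add)
          finally show ?case by (simp only: x_def)
        qed
        ultimately have "(\<lambda>k. ((1 - ?x k) * exp (?x k)) ^ k) \<longlonglongrightarrow> exp (1 / a * exp (- 2 * 0) * (- 1 / 2))"
          by (rule Lim_transform_eventually)
        then show ?thesis by (simp add: mult.commute)
      qed
      ultimately have "(\<lambda>k. ?f k y) \<longlonglongrightarrow> exp (c * 0) * exp (- y\<^sup>2) * exp (- 1 / (2 * a))"
        by (intro tendsto_mult)
      then show ?thesis by simp
    qed
  qed auto
  then show ?thesis
    by (simp only: integral_unique[OF has_integral_mult_left[OF gauss]])
qed

text \<open>
  The substitution \<open>1 - a ln s = a \<mu> exp (y / m)\<close>, with \<open>\<mu> = sqrt (k / a)\<close> and \<open>m = sqrt \<mu>\<close>, centres the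
  integrand at its saddle point and turns its exponent into \<open>- 2 \<mu> cosh (y / m)\<close>.
\<close>

lemma mixture_critical:
  fixes a \<delta> :: real
  assumes a: "a > 0" and \<delta>: "\<delta> > 0"
  shows "(\<lambda>k. neg_binomial_mixture \<delta> (\<lambda>s. 1 - 1 / (1 - a * ln s)) k /
      (exp (- 2 * sqrt (real k / a)) * real k powr (\<delta> / 2 - 3 / 4)))
    \<longlonglongrightarrow> exp (1 / (2 * a)) * a powr (- (\<delta> / 2 + 1 / 4)) * sqrt pi / Gamma \<delta>"
proof -
  define \<mu> m where "\<mu> = (\<lambda>k :: nat. sqrt (real k / a))" and "m = (\<lambda>k :: nat. sqrt (sqrt (real k / a)))"
  define u where "u = (\<lambda>k y. a * \<mu> k * exp (y / m k))"
  let ?S = "\<lambda>k. {- m k * ln (a * \<mu> k)<..}"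
  let ?f = "\<lambda>k y. exp ((1 - \<delta>) * (y / m k)) * exp (- 2 * \<mu> k * (cosh (y / m k) - 1)) *
    ((1 - 1 / u k y) * exp (1 / u k y)) ^ k"
  let ?q = "\<lambda>s. 1 - 1 / (1 - a * ln s)"
  let ?C = "\<lambda>k. pochhammer \<delta> k / fact k :: real"
  let ?J = "\<lambda>k. integral (?S k) (?f k)"
  have J: "?J \<longlonglongrightarrow> sqrt pi * exp (- 1 / (2 * a))"
    using saddle_integral_limit[OF a, of "1 - \<delta>"] by (simp only: \<mu>_def m_def u_def)
  have mix: "neg_binomial_mixture \<delta> ?q k =
      ?C k * exp (1 / a) * (m k * (a * \<mu> k) powr - \<delta>) * exp (- 2 * \<mu> k) * ?J k" if k: "k > 0" for k
  proof -
    define M \<nu> where "M = m k" and "\<nu> = \<mu> k"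
    have pos: "\<nu> > 0" "M > 0" "M\<^sup>2 = \<nu>" "real k = a * \<nu>\<^sup>2"
      using a k by (auto simp: \<mu>_def m_def M_def \<nu>_def)
    let ?T = "{- M * ln (a * \<nu>)<..}"
    let ?u = "\<lambda>y. a * \<nu> * exp (y / M)"
    \<comment> \<open>Inverse to \<open>1 - a * ln s = ?u y\<close>.\<close>
    let ?g = "\<lambda>y. exp ((1 - ?u y) / a)"
    have u1: "?u y > 1 \<longleftrightarrow> y \<in> ?T" for y
    proof -
      have "?u y > 1 \<longleftrightarrow> exp (y / M) > exp (- ln (a * \<nu>))"
        using pos a by (simp add: exp_minus field_simps)
      also have "\<dots> \<longleftrightarrow> y \<in> ?T" using pos by (simp add: field_simps)
      finally show ?thesis .
    qed
    have img: "?g ` ?T = {0<..<1}"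
    proof (intro equalityI subsetI)
      fix s assume "s \<in> ?g ` ?T"
      then obtain y where y: "y \<in> ?T" "s = ?g y" by blast
      have "(1 - ?u y) / a < 0" using u1[of y] y(1) a by (simp add: divide_neg_pos)
      then show "s \<in> {0<..<1}" unfolding y(2) by simp
    next
      fix s :: real
      assume s: "s \<in> {0<..<1}"
      define v where "v = 1 - a * ln s"
      have v: "v > 1" using s a by (simp add: v_def mult_pos_neg)
      define y where "y = M * ln (v / (a * \<nu>))"
      have uy: "?u y = v" using v a pos by (simp add: y_def)
      then have "y \<in> ?T" using u1[of y] v by simp
      moreover have "s = ?g y" unfolding uy using s a by (simp add: v_def)
      ultimately show "s \<in> ?g ` ?T" by blast
    qed
    have der: "(?g has_field_derivative - (\<nu> / M * exp (y / M) * ?g y)) (at y)" for y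
      using a pos by (auto intro!: derivative_eq_intros simp: field_simps)
    have inj: "inj_on ?g ?T"
      using a pos by (intro inj_onI) simp
    have "neg_binomial_mixture \<delta> ?q k = integral ?T (\<lambda>y. \<bar>- (\<nu> / M * exp (y / M) * ?g y)\<bar> * neg_binomial \<delta> k (?q (?g y)))"
    proof -
      have "(\<lambda>s. neg_binomial \<delta> k (?q s)) absolutely_integrable_on ?g ` ?T"
        unfolding img by (rule neg_binomial_mixture_absolutely_integrable[OF \<delta> growth_curve_critical[OF a]])
      from integral_substitution(2)[OF _ der inj this] show ?thesis
        unfolding img neg_binomial_mixture_def by simp
    qed
    also have "\<dots> = integral ?T (\<lambda>y. (?C k * exp (1 / a) * (M * (a * \<nu>) powr - \<delta>) * exp (- 2 * \<nu>)) * ?f k y)"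
    proof (rule integral_cong)
      fix y assume y: "y \<in> ?T"
      define t U where "t = y / M" and "U = ?u y"
      have U: "U > 1" using u1 y by (simp add: U_def)
      have q: "?q (?g y) = 1 - 1 / U" using a by (simp add: U_def)
      have "(1 / U) powr \<delta> = (a * \<nu>) powr - \<delta> * exp (- \<delta> * t)"
        using a pos by (simp add: U_def t_def powr_divide powr_mult powr_minus_divide exp_powr_real exp_minus inverse_eq_divide mult.commute)
      then have nb: "neg_binomial \<delta> k (?q (?g y)) = ?C k * ((a * \<nu>) powr - \<delta> * exp (- \<delta> * t)) * (1 - 1 / U) ^ k"
        unfolding neg_binomial_def q by simp
      have kU: "real k * (1 / U) = \<nu> * exp (- t)"
        using a pos by (simp add: U_def t_def exp_minus power2_eq_square field_simps)
      have g: "?g y = exp (1 / a) * exp (- \<nu> * exp t)"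
        using a by (simp add: t_def diff_divide_distrib flip: exp_add)
      \<comment> \<open>\<open>- exp t = - 2 * cosh t + exp (- t)\<close> isolates the symmetric
        saddle; the remainder \<open>\<nu> * exp (- t)\<close> equals \<open>k / U\<close> and joins
        \<open>(1 - 1 / U) ^ k\<close>, cancelling the linear term of its logarithm.\<close>
      have "exp (- \<nu> * exp t) = exp (- 2 * \<nu>) * exp (- 2 * \<nu> * (cosh t - 1)) * exp (\<nu> * exp (- t))"
        by (simp add: cosh_def algebra_simps flip: exp_add)
      also have "exp (\<nu> * exp (- t)) = exp (1 / U) ^ k"
        by (simp only: kU exp_of_nat_mult[symmetric])
      finally have e: "exp (- \<nu> * exp t) = exp (- 2 * \<nu>) * exp (- 2 * \<nu> * (cosh t - 1)) * exp (1 / U) ^ k" .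
      have et: "exp ((1 - \<delta>) * t) = exp t * exp (- \<delta> * t)"
        by (simp add: algebra_simps flip: exp_add)
      have "\<nu> / M = M" using pos by (simp add: power2_eq_square flip: pos(3))
      then have A: "\<bar>- (\<nu> / M * exp (y / M) * ?g y)\<bar> = M * exp t * ?g y"
        using pos by (simp add: abs_mult t_def)
      show "\<bar>- (\<nu> / M * exp (y / M) * ?g y)\<bar> * neg_binomial \<delta> k (?q (?g y)) =
          (?C k * exp (1 / a) * (M * (a * \<nu>) powr - \<delta>) * exp (- 2 * \<nu>)) * ?f k y"
        unfolding A nb
        unfolding g e
        unfolding u_def M_def[symmetric] \<nu>_def[symmetric]
        unfolding U_def[symmetric]
        unfolding t_def[symmetric] et power_mult_distrib
        by (simp only: mult_ac)
    qed
    also have "\<dots> = ?C k * exp (1 / a) * (M * (a * \<nu>) powr - \<delta>) * exp (- 2 * \<nu>) * integral ?T (?f k)"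
      by (rule integral_mult_right)
    finally show ?thesis by (simp only: M_def \<nu>_def)
  qed
  have eq: "(?C k * real k powr (1 - \<delta>)) * (exp (1 / a) * a powr (- (\<delta> / 2 + 1 / 4))) * ?J k =
      neg_binomial_mixture \<delta> ?q k / (exp (- 2 * sqrt (real k / a)) * real k powr (\<delta> / 2 - 3 / 4))" if k: "k > 0" for k
  proof -
    \<comment> \<open>Bookkeeping of exponents: \<open>m k\<close> is
      \<open>(k / a) powr (1 / 4)\<close> and \<open>a * \<mu> k\<close> is
      \<open>(a k) powr (1 / 2)\<close>.\<close>
    have "m k * (a * \<mu> k) powr - \<delta> = real k powr (1 - \<delta>) * a powr (- (\<delta> / 2 + 1 / 4)) * real k powr (\<delta> / 2 - 3 / 4)"
    proof -
      have "ln (a * \<mu> k) = (ln (real k) + ln a) / 2"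
        using k a by (simp add: \<mu>_def ln_mult ln_sqrt ln_div field_simps)
      then have "(a * \<mu> k) powr - \<delta> = exp (- \<delta> * ((ln (real k) + ln a) / 2))"
        using k a by (simp add: powr_def \<mu>_def)
      moreover have "m k = exp ((ln (real k) - ln a) / 4)"
      proof -
        have "m k > 0" using k a by (simp add: m_def)
        then have "m k = exp (ln (m k))" by simp
        also have "ln (m k) = (ln (real k) - ln a) / 4"
          using k a by (simp add: m_def ln_sqrt ln_div)
        finally show ?thesis .
      qed
      ultimately show ?thesis
        using k a by (simp add: powr_def field_simps flip: exp_add)
    qed
    then show ?thesis
      unfolding mix[OF k] using k by (simp add: \<mu>_def)
  qed
  have "(\<lambda>k. (?C k * real k powr (1 - \<delta>)) * (exp (1 / a) * a powr (- (\<delta> / 2 + 1 / 4))) * ?J k) \<longlonglongrightarrow>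
      1 / Gamma \<delta> * (exp (1 / a) * a powr (- (\<delta> / 2 + 1 / 4))) * (sqrt pi * exp (- 1 / (2 * a)))"
    by (intro tendsto_mult neg_binomial_coeff_asymp J tendsto_const \<delta>)
  then have "(\<lambda>k. neg_binomial_mixture \<delta> ?q k / (exp (- 2 * sqrt (real k / a)) * real k powr (\<delta> / 2 - 3 / 4))) \<longlonglongrightarrow>
      1 / Gamma \<delta> * (exp (1 / a) * a powr (- (\<delta> / 2 + 1 / 4))) * (sqrt pi * exp (- 1 / (2 * a)))"
    by (rule Lim_transform_eventually[OF _ eventually_mono[OF eventually_gt_at_top[of 0]]]) (rule eq)
  also have "1 / Gamma \<delta> * (exp (1 / a) * a powr (- (\<delta> / 2 + 1 / 4))) * (sqrt pi * exp (- 1 / (2 * a))) =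
      (exp (1 / a) * exp (- 1 / (2 * a))) * a powr (- (\<delta> / 2 + 1 / 4)) * sqrt pi / Gamma \<delta>"
    by simp
  \<comment> \<open>The factor \<open>exp (1 / a)\<close> stems from the constant part of
    \<open>ln s = (1 - u) / a\<close>, the other from the correction in
    \<open>saddle_integral_limit\<close>.\<close>
  also have "exp (1 / a) * exp (- 1 / (2 * a)) = exp (1 / (2 * a))"
    using a by (simp add: field_simps flip: exp_add)
  finally show ?thesis .
qed

theorem theorem3p2:
  fixes \<pi> \<delta> \<alpha>\<^sub>0 \<alpha>\<^sub>2 A B c :: real and p :: "nat \<Rightarrow> real"
  assumes "1 / 2 < \<pi>" and "\<pi> < 1" and "\<delta> > 0"
    and "\<And>k. (\<lambda>n. expected_degree_fraction \<pi> \<delta> n k) \<longlonglongrightarrow> p k"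
    and "\<alpha>\<^sub>0 = \<pi> / (2 * \<pi> - 1 + \<delta> * \<pi>)"
    and "\<alpha>\<^sub>2 = (1 - \<pi>) / (2 * \<pi> - 1)"
    and "\<alpha>\<^sub>0 \<noteq> \<alpha>\<^sub>2 \<Longrightarrow> B = 1 / (\<alpha>\<^sub>0 - \<alpha>\<^sub>2)"
    and "\<alpha>\<^sub>0 \<noteq> \<alpha>\<^sub>2 \<Longrightarrow> A = - (\<delta> + B)"
    and "c =
      (if \<alpha>\<^sub>0 < \<alpha>\<^sub>2 then (\<alpha>\<^sub>2 - \<alpha>\<^sub>0) powr (- (A + 1)) * \<alpha>\<^sub>2 powr A * Gamma (- B) / Gamma \<delta>
       else if \<alpha>\<^sub>0 = \<alpha>\<^sub>2 then
         exp (1 / (2 * \<alpha>\<^sub>0)) * \<alpha>\<^sub>0 powr (- (\<delta> / 2 + 1 / 4)) * sqrt pi / Gamma \<delta>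
       else (\<alpha>\<^sub>0 - \<alpha>\<^sub>2) powr (- (B + 1)) * \<alpha>\<^sub>0 powr B * Gamma (- A) / Gamma \<delta>)"
  shows "(\<lambda>k. p k /
      (if \<alpha>\<^sub>0 < \<alpha>\<^sub>2 then c * (\<alpha>\<^sub>0 / \<alpha>\<^sub>2) ^ k * real k powr (- (A + 1))
       else if \<alpha>\<^sub>0 = \<alpha>\<^sub>2 then
         c * exp (- 2 * \<alpha>\<^sub>0 powr (- 1 / 2) * real k powr (1 / 2)) * real k powr (\<delta> / 2 - 3 / 4)
       else c * real k powr (- (B + 1)))) \<longlonglongrightarrow> 1"
proof -
  have \<alpha>: "\<alpha>\<^sub>0 > 0" "\<alpha>\<^sub>2 > 0" using assms(1-3,5,6) by (auto intro!: divide_pos_pos add_pos_pos)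
  note limit = assms(1-4)
  \<comment> \<open>Any growth curve for these rates represents \<open>p\<close>, so each regime may
    pick its own formula.\<close>
  have mixture: "p = neg_binomial_mixture \<delta> q" if "growth_curve \<alpha>\<^sub>0 \<alpha>\<^sub>2 q" for q
  proof
    fix k
    show "p k = neg_binomial_mixture \<delta> q k"
    proof (rule neg_binomial_mixture_unique[OF assms(3) that \<alpha>])
      show "p k \<ge> 0" for k by (rule limit_nonneg[OF limit])
      show "(\<Sum>j\<le>k. p j) \<le> 1" for k by (rule limit_sum_le_1[OF limit])
      show "(\<Sum>j\<le>k. p j) = 1 - \<alpha>\<^sub>0 * (real k + \<delta>) * p k + \<alpha>\<^sub>2 * real (Suc k) * p (Suc k)" for k
        unfolding assms(5,6) by (rule limit_recurrence[OF limit])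
    qed
  qed
  \<comment> \<open>Division by the limit requires it to be nonzero; in every regime the Gamma
    arguments occurring in \<open>c\<close> are positive.\<close>
  have normalise: "(\<lambda>k. f k / (C * g k)) \<longlonglongrightarrow> 1"
    if "(\<lambda>k. f k / g k) \<longlonglongrightarrow> C" "C > 0" for f g :: "nat \<Rightarrow> real" and C
    using tendsto_divide[OF that(1) tendsto_const[of C]] that(2) by (simp add: mult.commute)
  consider "\<alpha>\<^sub>0 < \<alpha>\<^sub>2" | "\<alpha>\<^sub>0 = \<alpha>\<^sub>2" | "\<alpha>\<^sub>2 < \<alpha>\<^sub>0" by linarith
  then show ?thesis
  proof cases
    case 1
    define \<beta> where "\<beta> = 1 / (\<alpha>\<^sub>2 - \<alpha>\<^sub>0)"
    have \<beta>: "\<beta> > 0" using 1 by (simp add: \<beta>_def)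
    \<comment> \<open>In this regime \<open>B\<close> is negative, and \<open>- B\<close> is the
      positive exponent \<open>1 / (b - a)\<close> of \<open>mixture_subcritical\<close>.\<close>
    have "B = 1 / - (\<alpha>\<^sub>2 - \<alpha>\<^sub>0)" using assms(7) 1 by simp
    then have "B = - \<beta>" unfolding \<beta>_def minus_divide_right .
    then have AB: "A = \<beta> - \<delta>" "- B = \<beta>" "- (A + 1) = \<delta> - \<beta> - 1" using assms(8) 1 by auto
    have c: "c = (\<alpha>\<^sub>2 - \<alpha>\<^sub>0) powr (\<delta> - \<beta> - 1) * \<alpha>\<^sub>2 powr (\<beta> - \<delta>) * Gamma \<beta> / Gamma \<delta>"
      unfolding assms(9) AB(2,3) using 1 by (simp add: AB(1))
    have "(\<lambda>k. p k / (c * ((\<alpha>\<^sub>0 / \<alpha>\<^sub>2) ^ k * real k powr (\<delta> - \<beta> - 1)))) \<longlonglongrightarrow> 1"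
    proof (rule normalise)
      show "(\<lambda>k. p k / ((\<alpha>\<^sub>0 / \<alpha>\<^sub>2) ^ k * real k powr (\<delta> - \<beta> - 1))) \<longlonglongrightarrow> c"
        unfolding c mixture[OF growth_curve_subcritical[OF \<alpha> 1]] \<beta>_def
        by (rule mixture_subcritical[OF \<alpha> assms(3) 1])
      show "c > 0" unfolding c using 1 \<alpha> \<beta> assms(3) by (simp add: Gamma_real_pos)
    qed
    then show ?thesis using 1 unfolding AB(3) by (simp add: mult.assoc)
  next
    case 2
    have c: "c = exp (1 / (2 * \<alpha>\<^sub>0)) * \<alpha>\<^sub>0 powr (- (\<delta> / 2 + 1 / 4)) * sqrt pi / Gamma \<delta>"
      unfolding assms(9) using 2 by simp
    have curve: "growth_curve \<alpha>\<^sub>0 \<alpha>\<^sub>2 (\<lambda>s. 1 - 1 / (1 - \<alpha>\<^sub>0 * ln s))"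
      using growth_curve_critical[OF \<alpha>(1)] 2 by simp
    have e: "- 2 * \<alpha>\<^sub>0 powr (- 1 / 2) * real k powr (1 / 2) = - 2 * sqrt (real k / \<alpha>\<^sub>0)" for k
      using \<alpha> by (simp add: powr_minus_divide powr_half_sqrt real_sqrt_divide)
    have "(\<lambda>k. p k / (c * (exp (- 2 * sqrt (real k / \<alpha>\<^sub>0)) * real k powr (\<delta> / 2 - 3 / 4)))) \<longlonglongrightarrow> 1"
    proof (rule normalise)
      show "(\<lambda>k. p k / (exp (- 2 * sqrt (real k / \<alpha>\<^sub>0)) * real k powr (\<delta> / 2 - 3 / 4))) \<longlonglongrightarrow> c"
        unfolding c mixture[OF curve]
        by (rule mixture_critical[OF \<alpha>(1) assms(3)])
      show "c > 0" unfolding c using \<alpha> assms(3) by (simp add: Gamma_real_pos)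
    qed
    then show ?thesis using 2 unfolding e by (simp add: mult.assoc)
  next
    case 3
    define \<beta> where "\<beta> = 1 / (\<alpha>\<^sub>0 - \<alpha>\<^sub>2)"
    have \<beta>: "\<beta> > 0" using 3 by (simp add: \<beta>_def)
    have AB: "B = \<beta>" "- A = \<delta> + \<beta>" using assms(7,8) 3 by (auto simp: \<beta>_def)
    have c: "c = (\<alpha>\<^sub>0 - \<alpha>\<^sub>2) powr (- (\<beta> + 1)) * \<alpha>\<^sub>0 powr \<beta> * Gamma (\<delta> + \<beta>) / Gamma \<delta>"
      unfolding assms(9) using 3 by (simp add: AB)
    have "(\<lambda>k. p k / (c * real k powr (- (\<beta> + 1)))) \<longlonglongrightarrow> 1"
    proof (rule normalise)
      have "(\<lambda>k. p k * real k powr (\<beta> + 1)) \<longlonglongrightarrow> c"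
        unfolding c mixture[OF growth_curve_supercritical[OF \<alpha> 3]] \<beta>_def
        by (rule mixture_supercritical[OF \<alpha> assms(3) 3])
      then show "(\<lambda>k. p k / real k powr (- (\<beta> + 1))) \<longlonglongrightarrow> c"
        by (simp only: powr_minus divide_inverse inverse_inverse_eq)
      show "c > 0" unfolding c using 3 \<alpha> \<beta> assms(3) by (simp add: Gamma_real_pos)
    qed
    then show ?thesis using 3 unfolding AB by simp
  qed
qed

end
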